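(* For the Poisson $i\mathcal{S}$-graph $G_\rho$ with (deterministic) neutralization radius $\rho$, legitimate-node density $\lambda_\ell>0$ and eavesdropper density $\lambda_{\mathrm e}>0$, the average node degrees of a typical node are lower-bounded by $$\mathbb{E}\{N_{\mathrm{in}}\}=\mathbb{E}\{N_{\mathrm{out}}\}\ge\frac{\lambda_\ell}{\lambda_{\mathrm e}}\left(\pi\lambda_{\mathrm e}\rho^{2}+e^{\pi\lambda_\ell\rho^{2}}\right).$$
   Context: $\Pi_\ell=\{x_i\}$ (legitimate nodes) and $\Pi_{\mathrm e}$ (eavesdroppers) are mutually independent homogeneous Poisson point processes on $\mathbb{R}^2$ with densities $\lambda_\ell,\lambda_{\mathrm e}$. Neutralization: the total neutralization region is the union $\Theta=\bigcup_i \mathcal{B}_{x_i}(\rho)$ over all legitimate nodes $x_i$, where $\mathcal{B}_x(\rho)$ is the closed disc of centre $x$ and radius $\rho$. Eavesdroppers in $\Theta$ are removed, so the effective eavesdropper process is $\Pi_{\mathrm e}\cap\overline\Theta$ with $\overline\Theta=\mathbb{R}^2\setminus\Theta$. $G_\rho$ is the directed graph on the legitimate nodes with edge $\overrightarrow{xy}$ if and only if $|x-y|<|x-e|$ for every $e\in\Pi_{\mathrm e}\cap\overline\Theta$. Typical node: the node at the origin when everything (including $\Theta$) is built from the legitimate-node set $\Pi_\ell\cup\{0\}$, with eavesdroppers $\Pi_{\mathrm e}$. $N_{\mathrm{out}}$ (resp. $N_{\mathrm{in}}$) is the number of $x\in\Pi_\ell$ with an edge $\overrightarrow{0x}$ (resp.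 $\overrightarrow{x0}$). *)

theory Defs
  imports "HOL-Probability.Probability"
begin

definition configurations :: "'a::euclidean_space set set" where
  "configurations = {S. \<forall>B. bounded B \<longrightarrow> finite (S \<inter> B)}"

text \<open>The smallest sigma-algebra on the locally finite subsets that makes every count
  \<open>S \<mapsto> card (S \<inter> B)\<close>, with \<open>B\<close> bounded and Borel, measurable.\<close>

definition configuration_space :: "'a::euclidean_space set measure" where
  "configuration_space = sigma configurations
     {{S \<in> configurations. card (S \<inter> B) = k} | B k. B \<in> sets borel \<and> bounded B}"

text \<open>The Poisson law is written out explicitly because the library's \<open>poisson_pmf\<close> requires a
  strictly positive rate, whereas here \<open>B\<close> may be a null set (then \<open>0 ^ 0 = 1\<close> gives the
  point mass at 0).\<close>

definition homogeneous_poisson_process ::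
    "'w measure \<Rightarrow> real \<Rightarrow> ('w \<Rightarrow> 'a::euclidean_space set) \<Rightarrow> bool" where
  "homogeneous_poisson_process M d P \<longleftrightarrow>
     P \<in> M \<rightarrow>\<^sub>M configuration_space \<and>
     (\<forall>B k. B \<in> sets borel \<longrightarrow> bounded B \<longrightarrow>
        measure M {\<omega> \<in> space M. card (P \<omega> \<inter> B) = k} =
          (d * measure lborel B) ^ k / fact k * exp (- (d * measure lborel B))) \<and>
     (\<forall>B :: nat \<Rightarrow> 'a set.
        (\<forall>i. B i \<in> sets borel \<and> bounded (B i)) \<longrightarrow> disjoint_family B \<longrightarrow>
        prob_space.indep_vars M (\<lambda>_. count_space UNIV) (\<lambda>i \<omega>. card (P \<omega> \<inter> B i)) UNIV)"

type_synonym plane = "real ^ 2"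

definition neutralization_region :: "real \<Rightarrow> plane set \<Rightarrow> plane set" where
  "neutralization_region \<rho> L = (\<Union>x\<in>L. cball x \<rho>)"

definition iS_edges :: "real \<Rightarrow> plane set \<Rightarrow> plane set \<Rightarrow> (plane \<times> plane) set" where
  "iS_edges \<rho> L E = {(x, y). x \<in> L \<and> y \<in> L \<and>
     (\<forall>e \<in> E \<inter> - neutralization_region \<rho> L. dist x y < dist x e)}"

text \<open>Degrees of the node at the origin after adding it to the legitimate nodes \<open>L\<close>.  The
  cardinalities are taken in \<^typ>\<open>ennreal\<close>, since a priori they may be infinite.\<close>

definition N_out :: "real \<Rightarrow> plane set \<Rightarrow> plane set \<Rightarrow> ennreal" where
  "N_out \<rho> L E = emeasure (count_space UNIV) {x \<in> L. (0, x) \<in> iS_edges \<rho> (insert 0 L) E}"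

definition N_in :: "real \<Rightarrow> plane set \<Rightarrow> plane set \<Rightarrow> ennreal" where
  "N_in \<rho> L E = emeasure (count_space UNIV) {x \<in> L. (x, 0) \<in> iS_edges \<rho> (insert 0 L) E}"

end

theory Submission
  imports Defs
begin

text \<open>By the Mecke formula the expected degree is \<open>d\<^sub>l\<close> times the integral over \<open>x\<close> of the probability
  that the edge between \<open>0\<close> and \<open>x\<close> is present once \<open>x\<close> is added to the legitimate nodes.  Given
  these nodes, an edge starting in \<open>c\<close> is present with probability \<open>exp (- d\<^sub>e * V)\<close>, where \<open>V\<close> is the
  area of the part of the disc about \<open>c\<close> of radius \<open>norm x\<close> that is not neutralized.
  The reflection \<open>y \<mapsto> x - y\<close> exchanges \<open>0\<close> and \<open>x\<close> and preserves the Poisson law, so the two mean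
  degrees agree.  For the bound, the probability is 1 if \<open>norm x \<le> \<rho>\<close>.  Otherwise each point of the
  annulus between the radii \<open>\<rho>\<close> and \<open>norm x\<close> escapes neutralization with probability at most
  \<open>exp (- pi * d\<^sub>l * \<rho>\<^sup>2)\<close>; this bounds the mean of \<open>V\<close>, Jensen's inequality bounds the edge probability
  from below, and the resulting Gaussian integral is explicit.\<close>

section \<open>Measurability on the space of configurations\<close>

text \<open>The obstacle is that the process is given only through counts in bounded Borel sets,
  whereas the Mecke formula concerns functions of the whole configuration. The proof therefore
  passes to laws on \<open>configuration_space\<close>, which are determined by their values on
  cylinder events over finitely many disjoint cells; there the Mecke formula is an elementary
  identity between Poisson weights. Bounded windows keep the measures finite, so that complements
  can be treated by subtraction.

  The two terms of the bound belong to two regions. For \<open>norm x \<le> \<rho>\<close> the node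
  at the origin neutralizes the whole relevant disc, which contributes the area
  \<open>pi * \<rho>\<^sup>2\<close>. Outside, Jensen gives
  \<open>exp (- c * ((norm x)\<^sup>2 - \<rho>\<^sup>2))\<close> with
  \<open>c = pi * d\<^sub>e * exp (- pi * d\<^sub>l * \<rho>\<^sup>2)\<close>, whose integral
  \<open>pi / c\<close> is \<open>exp (pi * d\<^sub>l * \<rho>\<^sup>2) / d\<^sub>e\<close>.\<close>

lemma space_configuration_space [simp]: "space configuration_space = configurations"
  unfolding configuration_space_def by (auto intro!: space_measure_of)

lemma sets_configuration_space:
  "sets configuration_space = sigma_sets configurations
     {{S \<in> configurations. card (S \<inter> B) = k} | B k. B \<in> sets borel \<and> bounded B}"
  unfolding configuration_space_def by (intro sets_measure_of) auto

lemma finite_configuration_Int: "S \<in> configurations \<Longrightarrow> bounded B \<Longrightarrow> finite (S \<inter> B)"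
  by (auto simp: configurations_def)

text \<open>Makes the counting measure on a configuration sigma-finite, as Fubini requires when a
  mean over eavesdroppers is exchanged with a sum over nodes.\<close>

lemma countable_configuration:
  fixes S :: "'a::euclidean_space set"
  assumes "S \<in> configurations"
  shows "countable S"
proof -
  have *: "S = (\<Union>n::nat. S \<inter> ball 0 (real n))"
    by (auto simp: reals_Archimedean2)
  have "countable (S \<inter> ball 0 (real n))" for n
    using assms by (simp add: countable_finite finite_configuration_Int)
  then have "countable (\<Union>n::nat. S \<inter> ball 0 (real n))"
    by (intro countable_UN) auto
  then show ?thesis
    by (subst *)
qed

lemma measurable_card_Int [measurable]:
  fixes B :: "'a::euclidean_space set"
  assumes "B \<in> sets borel" "bounded B"
  shows "(\<lambda>S. card (S \<inter> B)) \<in> configuration_space \<rightarrow>\<^sub>M count_space UNIV"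
proof -
  have "(\<lambda>S. card (S \<inter> B)) -` {k} \<inter> space configuration_space \<in> sets configuration_space" for k
  proof -
    have "(\<lambda>S. card (S \<inter> B)) -` {k} \<inter> space configuration_space = {S \<in> configurations. card (S \<inter> B) = k}"
      by auto
    then show ?thesis
      using assms by (auto simp: sets_configuration_space)
  qed
  then show ?thesis
    by (simp add: measurable_count_space_eq2_countable)
qed

lemma measurable_configuration_space:
  fixes f :: "'b \<Rightarrow> 'a::euclidean_space set"
  assumes "\<And>x. x \<in> space N \<Longrightarrow> f x \<in> configurations"
    and "\<And>B. B \<in> sets borel \<Longrightarrow> bounded B \<Longrightarrow> (\<lambda>x. card (f x \<inter> B)) \<in> N \<rightarrow>\<^sub>M count_space UNIV"
  shows "f \<in> N \<rightarrow>\<^sub>M configuration_space"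
  unfolding configuration_space_def
proof (rule measurable_measure_of)
  fix Y :: "'a set set" assume "Y \<in> {{S \<in> configurations. card (S \<inter> B) = k} | B k. B \<in> sets borel \<and> bounded B}"
  then obtain B k where B: "B \<in> sets borel" "bounded B" and Y: "Y = {S \<in> configurations. card (S \<inter> B) = k}"
    by auto
  have "(\<lambda>x. card (f x \<inter> B)) -` {k} \<inter> space N \<in> sets N"
    using assms(2)[OF B] by (rule measurable_sets) simp
  also have "(\<lambda>x. card (f x \<inter> B)) -` {k} \<inter> space N = f -` Y \<inter> space N"
    using assms(1) Y by auto
  finally show "f -` Y \<inter> space N \<in> sets N" .
qed (use assms in auto)

lemma sum_indicator_rectangle:
  assumes fin: "finite (S \<inter> U)"
  shows "(\<integral>\<^sup>+x. indicator (a \<times> b) (x, z) \<partial>count_space (S \<inter> U)) = of_nat (card (S \<inter> (U \<inter> a))) * indicator b z"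
proof -
  have "(\<integral>\<^sup>+x. indicator (a \<times> b) (x, z) \<partial>count_space (S \<inter> U)) = (\<Sum>x\<in>S \<inter> U. indicator a x * indicator b z)"
    using fin by (simp add: nn_integral_count_space_finite indicator_times)
  also have "\<dots> = (\<Sum>x\<in>S \<inter> U. indicator a x) * indicator b z"
    by (simp add: sum_distrib_right)
  also have "(\<Sum>x\<in>S \<inter> U. indicator a x) = (of_nat (card (S \<inter> (U \<inter> a))) :: ennreal)"
    using fin by (simp add: indicator_def sum.If_cases Int_def conj_assoc)
  finally show ?thesis .
qed

text \<open>Dynkin argument over rectangles, where the sum is a count times an indicator. The
  complement step subtracts in \<open>ennreal\<close>, which is sound because boundedness of
  \<open>U\<close> makes the sums finite.\<close>

lemma borel_measurable_sum_indicator_bounded: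
  fixes U :: "'a::euclidean_space set"
  assumes U: "U \<in> sets borel" "bounded U" and D: "D \<in> sets (borel \<Otimes>\<^sub>M N)"
  shows "(\<lambda>(S, z). \<integral>\<^sup>+x. indicator D (x, z) \<partial>count_space (S \<inter> U))
    \<in> borel_measurable (configuration_space \<Otimes>\<^sub>M N)"
  using Int_stable_pair_measure_generator pair_measure_closed D[unfolded sets_pair_measure]
proof (induction rule: sigma_sets_induct_disjoint)
  case (basic R)
  then obtain a b where [measurable]: "a \<in> sets (borel::'a measure)" "b \<in> sets N" and R: "R = a \<times> b"
    by auto
  have [measurable]: "(\<lambda>S. card (S \<inter> (U \<inter> a))) \<in> configuration_space \<rightarrow>\<^sub>M count_space UNIV"
    using U by (intro measurable_card_Int) (auto intro: bounded_subset)
  have "(\<lambda>(S, z). of_nat (card (S \<inter> (U \<inter> a))) * indicator b z :: ennreal) \<in> borel_measurable (configuration_space \<Otimes>\<^sub>M N)"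
    unfolding ennreal_of_nat_eq_real_of_nat by measurable
  moreover have "(\<integral>\<^sup>+x. indicator R (x, z) \<partial>count_space (S \<inter> U)) = of_nat (card (S \<inter> (U \<inter> a))) * indicator b z"
    if "S \<in> configurations" for S :: "'a set" and z
    unfolding R using that U by (intro sum_indicator_rectangle finite_configuration_Int)
  ultimately show ?case
    by (subst measurable_cong[where g = "\<lambda>(S, z). of_nat (card (S \<inter> (U \<inter> a))) * indicator b z"])
       (auto simp: space_pair_measure)
next
  case empty
  then show ?case by simp
next
  case (compl R)
  have [measurable]: "(\<lambda>S. card (S \<inter> U)) \<in> configuration_space \<rightarrow>\<^sub>M count_space UNIV"
    using U by (intro measurable_card_Int)
  have [measurable]: "(\<lambda>(S, z). \<integral>\<^sup>+x. indicator R (x, z) \<partial>count_space (S \<inter> U))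
    \<in> borel_measurable (configuration_space \<Otimes>\<^sub>M N)"
    using compl by (simp add: sets_pair_measure)
  have "(\<lambda>(S, z). ennreal (real (card (S \<inter> U))) - (\<integral>\<^sup>+x. indicator R (x, z) \<partial>count_space (S \<inter> U)))
     \<in> borel_measurable (configuration_space \<Otimes>\<^sub>M N)"
    by measurable
  moreover have "(\<integral>\<^sup>+x. indicator (space borel \<times> space N - R) (x, z) \<partial>count_space (S \<inter> U)) =
      ennreal (real (card (S \<inter> U))) - (\<integral>\<^sup>+x. indicator R (x, z) \<partial>count_space (S \<inter> U))"
    if "S \<in> configurations" "z \<in> space N" for S :: "'a set" and z
  proof -
    have fin: "finite (S \<inter> U)" using that U by (simp add: finite_configuration_Int)
    have "(\<integral>\<^sup>+x. indicator (space borel \<times> space N - R) (x, z) \<partial>count_space (S \<inter> U)) +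
        (\<integral>\<^sup>+x. indicator R (x, z) \<partial>count_space (S \<inter> U)) = (\<integral>\<^sup>+x. 1 \<partial>count_space (S \<inter> U))"
      using that(2) by (subst nn_integral_add[symmetric]) (simp, simp, rule nn_integral_cong, auto simp: indicator_def)
    also have "\<dots> = ennreal (real (card (S \<inter> U)))"
      using fin by (simp add: nn_integral_count_space_finite ennreal_of_nat_eq_real_of_nat)
    finally have eq: "(\<integral>\<^sup>+x. indicator (space borel \<times> space N - R) (x, z) \<partial>count_space (S \<inter> U)) +
        (\<integral>\<^sup>+x. indicator R (x, z) \<partial>count_space (S \<inter> U)) = ennreal (real (card (S \<inter> U)))" .
    then have "(\<integral>\<^sup>+x. indicator R (x, z) \<partial>count_space (S \<inter> U)) \<noteq> \<top>"
      by (metis ennreal_add_eq_top ennreal_neq_top)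
    then show ?thesis
      unfolding eq[symmetric] by simp
  qed
  ultimately show ?case
    by (subst measurable_cong[where g = "\<lambda>(S, z). ennreal (real (card (S \<inter> U))) - (\<integral>\<^sup>+x. indicator R (x, z) \<partial>count_space (S \<inter> U))"])
       (auto simp: space_pair_measure)
next
  case (union R)
  have "(\<integral>\<^sup>+x. indicator (\<Union>i. R i) (x, z) \<partial>count_space (S \<inter> U)) =
    (\<Sum>i. \<integral>\<^sup>+x. indicator (R i) (x, z) \<partial>count_space (S \<inter> U))" for S :: "'a set" and z
    using union(1) by (subst nn_integral_suminf[symmetric]) (auto simp: suminf_indicator)
  then have "(\<lambda>(S, z). \<integral>\<^sup>+x. indicator (\<Union>i. R i) (x, z) \<partial>count_space (S \<inter> U)) =
      (\<lambda>y. \<Sum>i. (case y of (S, z) \<Rightarrow> \<integral>\<^sup>+x. indicator (R i) (x, z) \<partial>count_space (S \<inter> U)))"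
    by (auto simp: fun_eq_iff)
  also have "\<dots> \<in> borel_measurable (configuration_space \<Otimes>\<^sub>M N)"
    using union by (intro borel_measurable_suminf_order) auto
  finally show ?case .
qed

text \<open>Lifts results from bounded windows, where all sums are finite, to whole configurations
  by monotone convergence.\<close>

lemma nn_integral_count_space_balls:
  fixes f :: "'a::euclidean_space \<Rightarrow> ennreal"
  shows "(\<integral>\<^sup>+x. f x \<partial>count_space S) = (SUP n. \<integral>\<^sup>+x. f x \<partial>count_space (S \<inter> ball 0 (real n)))"
proof -
  have "(\<integral>\<^sup>+x. f x \<partial>count_space S) =
    (\<integral>\<^sup>+x. (SUP n. f x * indicator (ball 0 (real n)) x) \<partial>count_space S)"
  proof (rule nn_integral_cong)
    fix x :: 'a
    obtain n where "norm x < real n" using reals_Archimedean2 by blast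
    then have "f x \<le> (SUP n. f x * indicator (ball 0 (real n)) x)"
      by (intro SUP_upper2[of n]) auto
    moreover have "(SUP n. f x * indicator (ball 0 (real n)) x) \<le> f x"
      by (intro SUP_least) (auto simp: indicator_def)
    ultimately show "f x = (SUP n. f x * indicator (ball 0 (real n)) x)"
      by (rule antisym)
  qed
  also have "\<dots> = (SUP n. \<integral>\<^sup>+x. f x * indicator (ball 0 (real n)) x \<partial>count_space S)"
    by (rule nn_integral_monotone_convergence_SUP)
       (auto simp: incseq_def le_fun_def indicator_def)
  also have "\<dots> = (SUP n. \<integral>\<^sup>+x. f x \<partial>count_space (S \<inter> ball 0 (real n)))"
  proof (intro SUP_cong refl)
    fix n :: nat
    show "(\<integral>\<^sup>+x. f x * indicator (ball 0 (real n)) x \<partial>count_space S) =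
      (\<integral>\<^sup>+x. f x \<partial>count_space (S \<inter> ball 0 (real n)))"
      by (subst (1 2) nn_integral_count_space_indicator) (auto intro!: nn_integral_cong simp: indicator_def)
  qed
  finally show ?thesis .
qed

text \<open>The parameter \<open>z\<close> is kept general so that it can later be the configuration
  \<open>S\<close> itself, by restriction to the diagonal, or a pair that contains further points
  and configurations.\<close>

lemma borel_measurable_sum_configuration:
  fixes f :: "'a::euclidean_space \<times> 'b \<Rightarrow> ennreal"
  assumes "f \<in> borel_measurable (borel \<Otimes>\<^sub>M N)"
  shows "(\<lambda>(S, z). \<integral>\<^sup>+x. f (x, z) \<partial>count_space S) \<in> borel_measurable (configuration_space \<Otimes>\<^sub>M N)"
  using assms
proof (induction rule: borel_measurable_induct)
  case (cong f g)
  have "(\<lambda>(S, z). \<integral>\<^sup>+x. f (x, z) \<partial>count_space S) \<in> borel_measurable (configuration_space \<Otimes>\<^sub>M N) \<longleftrightarrow>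
    (\<lambda>(S, z). \<integral>\<^sup>+x. g (x, z) \<partial>count_space S) \<in> borel_measurable (configuration_space \<Otimes>\<^sub>M N)"
    using cong(3) by (intro measurable_cong) (auto simp: space_pair_measure intro!: nn_integral_cong)
  then show ?case using cong by simp
next
  case (set D)
  have "(\<lambda>(S, z). \<integral>\<^sup>+x. indicator D (x, z) \<partial>count_space S) =
    (\<lambda>y. SUP n. (case y of (S, z) \<Rightarrow> \<integral>\<^sup>+x. indicator D (x, z) \<partial>count_space (S \<inter> ball 0 (real n))))"
    unfolding case_prod_beta by (intro ext nn_integral_count_space_balls)
  also have "\<dots> \<in> borel_measurable (configuration_space \<Otimes>\<^sub>M N)"
    using set by (intro borel_measurable_SUP borel_measurable_sum_indicator_bounded) auto
  finally show ?case .
next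
  case (mult u c)
  have "(\<lambda>(S, z). \<integral>\<^sup>+x. c * u (x, z) \<partial>count_space S) = (\<lambda>y. c * (case y of (S, z) \<Rightarrow> \<integral>\<^sup>+x. u (x, z) \<partial>count_space S))"
    by (auto simp: fun_eq_iff nn_integral_cmult)
  then show ?case using mult by simp
next
  case (add u v)
  have "(\<lambda>(S, z). \<integral>\<^sup>+x. v (x, z) + u (x, z) \<partial>count_space S) =
    (\<lambda>y. (case y of (S, z) \<Rightarrow> \<integral>\<^sup>+x. v (x, z) \<partial>count_space S) + (case y of (S, z) \<Rightarrow> \<integral>\<^sup>+x. u (x, z) \<partial>count_space S))"
    by (auto simp: fun_eq_iff nn_integral_add)
  then show ?case using add by simp
next
  case (seq U)
  have "(\<integral>\<^sup>+x. (SUP i. U i) (x, z) \<partial>count_space S) = (SUP i. \<integral>\<^sup>+x. U i (x, z) \<partial>count_space S)" for S :: "'a set" and z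
    using \<open>incseq U\<close> unfolding SUP_apply
    by (intro nn_integral_monotone_convergence_SUP) (auto simp: incseq_def le_fun_def)
  then have "(\<lambda>(S, z). \<integral>\<^sup>+x. (SUP i. U i) (x, z) \<partial>count_space S) =
    (\<lambda>y. SUP i. (case y of (S, z) \<Rightarrow> \<integral>\<^sup>+x. U i (x, z) \<partial>count_space S))"
    by (auto simp: fun_eq_iff)
  also have "\<dots> \<in> borel_measurable (configuration_space \<Otimes>\<^sub>M N)"
    using seq by (intro borel_measurable_SUP) auto
  finally show ?case .
qed

text \<open>A universal statement over the points of \<open>S\<close> holds iff the number of
  violating points, a measurable sum over \<open>S\<close>, vanishes.\<close>

lemma pred_Ball_configuration:
  fixes P :: "'a::euclidean_space \<Rightarrow> 'b \<Rightarrow> bool"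
  assumes "Measurable.pred (borel \<Otimes>\<^sub>M N) (\<lambda>(x, z). P x z)"
  shows "Measurable.pred (configuration_space \<Otimes>\<^sub>M N) (\<lambda>(S, z). \<forall>x\<in>S. P x z)"
proof -
  have [measurable]: "(\<lambda>(S, z). \<integral>\<^sup>+x. (case (x, z) of (x, z) \<Rightarrow> if P x z then 0 else 1) \<partial>count_space S)
      \<in> borel_measurable (configuration_space \<Otimes>\<^sub>M N)"
    using assms by (intro borel_measurable_sum_configuration) (simp add: case_prod_beta)
  have "(\<lambda>(S, z). \<forall>x\<in>S. P x z) =
      (\<lambda>y. (case y of (S, z) \<Rightarrow> \<integral>\<^sup>+x. (case (x, z) of (x, z) \<Rightarrow> if P x z then 0 else 1) \<partial>count_space S) = (0::ennreal))"
    by (auto simp: fun_eq_iff nn_integral_0_iff_AE AE_count_space)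
  also have "Measurable.pred (configuration_space \<Otimes>\<^sub>M N) \<dots>"
    by measurable
  finally show ?thesis .
qed

text \<open>Since \<open>x\<close> varies together with \<open>S\<close>, no count in a fixed Borel
  set expresses membership; it is obtained as the negation of "every point of \<open>S\<close>
  differs from \<open>x\<close>".\<close>

lemma pred_mem_configuration [measurable]:
  "Measurable.pred (borel \<Otimes>\<^sub>M configuration_space) (\<lambda>(x::'a::euclidean_space, S). x \<in> S)"
proof -
  have "Measurable.pred (configuration_space \<Otimes>\<^sub>M borel) (\<lambda>(S, x::'a). \<forall>y\<in>S. y \<noteq> x)"
    by (rule pred_Ball_configuration) simp
  then have [measurable]: "Measurable.pred (configuration_space \<Otimes>\<^sub>M borel) (\<lambda>z. \<forall>y\<in>fst z. y \<noteq> (snd z :: 'a))"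
    by (simp add: case_prod_beta)
  have "Measurable.pred (borel \<Otimes>\<^sub>M configuration_space) (\<lambda>(x::'a, S). \<not> (\<forall>y\<in>fst (S, x). y \<noteq> snd (S, x)))"
    by measurable
  then show ?thesis
    by (simp add: case_prod_beta)
qed

section \<open>Insertion of a point into a configuration\<close>

lemma configurations_insert [simp]: "S \<in> configurations \<Longrightarrow> insert x S \<in> configurations"
  by (auto simp: configurations_def Int_insert_left)

text \<open>The count in \<open>B\<close> grows by one only if \<open>x\<close> lies in
  \<open>B\<close> and is not already a point of \<open>S\<close>; this is where joint measurability
  of membership enters.\<close>

lemma measurable_insert_configuration [measurable]:
  "(\<lambda>(x::'a::euclidean_space, S). insert x S) \<in> borel \<Otimes>\<^sub>M configuration_space \<rightarrow>\<^sub>M configuration_space"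
proof (rule measurable_configuration_space)
  fix z :: "'a \<times> 'a set" assume "z \<in> space (borel \<Otimes>\<^sub>M configuration_space)"
  then show "(case z of (x, S) \<Rightarrow> insert x S) \<in> configurations"
    by (auto simp: space_pair_measure)
next
  fix B :: "'a set" assume [measurable]: "B \<in> sets borel" "bounded B"
  have [measurable]: "Measurable.pred (borel \<Otimes>\<^sub>M configuration_space) (\<lambda>z. (fst z :: 'a) \<in> snd z)"
    using pred_mem_configuration by (simp add: case_prod_beta)
  have meas: "(\<lambda>z. card (snd z \<inter> B) + (if fst z \<in> B \<and> \<not> fst z \<in> snd z then 1 else 0))
      \<in> borel \<Otimes>\<^sub>M configuration_space \<rightarrow>\<^sub>M count_space UNIV"
    by measurable
  have eq: "card ((case z of (x, S) \<Rightarrow> insert x S) \<inter> B) =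
     card (snd z \<inter> B) + (if fst z \<in> B \<and> \<not> fst z \<in> snd z then 1 else 0)"
    if "z \<in> space (borel \<Otimes>\<^sub>M configuration_space)" for z :: "'a \<times> 'a set"
    using that \<open>bounded B\<close>
    by (auto simp: space_pair_measure Int_insert_left finite_configuration_Int card_insert_if insert_absorb)
  show "(\<lambda>z. card ((case z of (x, S) \<Rightarrow> insert x S) \<inter> B))
      \<in> borel \<Otimes>\<^sub>M configuration_space \<rightarrow>\<^sub>M count_space UNIV"
    (is "?f \<in> _")
  proof -
    have "?f \<in> borel \<Otimes>\<^sub>M configuration_space \<rightarrow>\<^sub>M count_space UNIV \<longleftrightarrow>
      (\<lambda>z. card (snd z \<inter> B) + (if fst z \<in> B \<and> \<not> fst z \<in> snd z then 1 else 0))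
        \<in> borel \<Otimes>\<^sub>M configuration_space \<rightarrow>\<^sub>M count_space UNIV"
      by (rule measurable_cong) (rule eq)
    then show ?thesis using meas by blast
  qed
qed

lemma measurable_insert_const [measurable]:
  "insert x \<in> configuration_space \<rightarrow>\<^sub>M (configuration_space :: 'a::euclidean_space set measure)"
  using measurable_compose[OF measurable_Pair1' measurable_insert_configuration, of x] by simp

lemma measurable_Pair_insert:
  "(\<lambda>S. (x, insert x S)) \<in>
    configuration_space \<rightarrow>\<^sub>M borel \<Otimes>\<^sub>M (configuration_space :: 'a::euclidean_space set measure)"
  by (intro measurable_Pair) simp_all

lemma measurable_case_Pair_insert:
  "(\<lambda>(x, S). (x, insert x S)) \<in> borel \<Otimes>\<^sub>M configuration_space
    \<rightarrow>\<^sub>M borel \<Otimes>\<^sub>M (configuration_space :: 'a::euclidean_space set measure)"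
  using measurable_insert_configuration by (simp add: case_prod_beta)

section \<open>Laws are determined by counts in disjoint sets\<close>

text \<open>For a finite disjoint family of bounded Borel cells these are the finite-dimensional
  events, whose Poisson probabilities are explicit products.\<close>

definition cylinder :: "'a::euclidean_space set set \<Rightarrow> ('a set \<Rightarrow> nat) \<Rightarrow> 'a set set" where
  "cylinder \<C> m = {S \<in> configurations. \<forall>C\<in>\<C>. card (S \<inter> C) = m C}"

lemma sets_cylinder:
  assumes "finite \<C>" "\<And>C. C \<in> \<C> \<Longrightarrow> C \<in> sets borel \<and> bounded C"
  shows "cylinder \<C> m \<in> sets configuration_space"
proof -
  have "Measurable.pred configuration_space (\<lambda>S. \<forall>C\<in>\<C>. card (S \<inter> C) = m C)"
  proof (rule pred_intros_finite(3)[OF assms(1)])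
    fix C assume "C \<in> \<C>"
    then have [measurable]: "(\<lambda>S. card (S \<inter> C)) \<in> configuration_space \<rightarrow>\<^sub>M count_space UNIV"
      using assms(2) by (intro measurable_card_Int) auto
    show "Measurable.pred configuration_space (\<lambda>S. card (S \<inter> C) = m C)"
      by measurable
  qed
  then show ?thesis
    by (simp add: pred_def cylinder_def)
qed

lemma finite_disjoint_refinement:
  assumes "finite \<B>" "\<And>B. B \<in> \<B> \<Longrightarrow> B \<in> sets borel \<and> bounded (B :: 'a::euclidean_space set)"
  obtains \<C> where "finite \<C>" "disjoint \<C>" "\<And>C. C \<in> \<C> \<Longrightarrow> C \<in> sets borel \<and> bounded C"
    "\<And>B. B \<in> \<B> \<Longrightarrow> B = \<Union>{C \<in> \<C>. C \<subseteq> B}"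
proof -
  \<comment> \<open>For \<open>I \<subseteq> \<B>\<close>, \<open>cell I\<close> holds the points
    that lie in exactly the members \<open>I\<close> of \<open>\<B>\<close>, that is, an atom of the
    generated algebra. Excluding \<open>I = {}\<close> keeps the cells bounded.\<close>
  define cell where "cell I = \<Inter>I - \<Union>(\<B> - I)" for I :: "'a set set"
  define \<C> where "\<C> = cell ` (Pow \<B> - {{}})"
  show thesis
  proof
    show "finite \<C>" using assms(1) by (simp add: \<C>_def)
    show "disjoint \<C>"
    proof (rule disjointI)
      fix X Y assume "X \<in> \<C>" "Y \<in> \<C>" "X \<noteq> Y"
      then obtain I J where I: "I \<subseteq> \<B>" "X = cell I" and J: "J \<subseteq> \<B>" "Y = cell J" and "I \<noteq> J"
        by (auto simp: \<C>_def)
      then obtain B where "B \<in> \<B>" "B \<in> I \<and> B \<notin> J \<or> B \<notin> I \<and> B \<in> J"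
        by blast
      then show "X \<inter> Y = {}"
        by (auto simp: I J cell_def)
    qed
    show "C \<in> sets borel \<and> bounded C" if C: "C \<in> \<C>" for C
    proof -
      from C obtain I where I: "I \<subseteq> \<B>" "I \<noteq> {}" "C = cell I" by (auto simp: \<C>_def)
      have "finite I" using I assms(1) finite_subset by blast
      then have "C \<in> sets borel"
        using I(1,2) assms sets.finite_INT[of I "\<lambda>B. B" borel] unfolding I(3) cell_def
        by (intro sets.Diff sets.finite_Union) auto
      moreover have "bounded C"
      proof -
        from I(2) obtain B where "B \<in> I" by blast
        then have "bounded B" "C \<subseteq> B"
          using I(1,3) assms(2) by (auto simp: cell_def)
        then show ?thesis by (rule bounded_subset)
      qed
      ultimately show ?thesis by simp
    qed
    show "B = \<Union>{C \<in> \<C>. C \<subseteq> B}" if B: "B \<in> \<B>" for B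
    proof (intro equalityI subsetI)
      fix x assume x: "x \<in> B"
      let ?I = "{B' \<in> \<B>. x \<in> B'}"
      have "cell ?I \<in> \<C>" using x B by (auto simp: \<C>_def)
      moreover have "cell ?I \<subseteq> B" "x \<in> cell ?I" using x B by (auto simp: cell_def)
      ultimately show "x \<in> \<Union>{C \<in> \<C>. C \<subseteq> B}" by blast
    qed blast
  qed
qed

text \<open>The additional set \<open>A\<close> serves the Mecke formula, where one of the measures has density
  \<open>card (S \<inter> A)\<close>: that density is constant on a cylinder whose cells partition \<open>A\<close>.\<close>

lemma measure_eqI_cylinder:
  fixes \<mu> \<nu> :: "'a::euclidean_space set measure"
  assumes sets: "sets \<mu> = sets configuration_space" "sets \<nu> = sets configuration_space"
    and fin: "emeasure \<mu> configurations \<noteq> \<infinity>"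
    and A: "A \<in> sets borel" "bounded A"
    and eq: "\<And>\<C> m. finite \<C> \<Longrightarrow> disjoint \<C> \<Longrightarrow> (\<And>C. C \<in> \<C> \<Longrightarrow> C \<in> sets borel \<and> bounded C) \<Longrightarrow>
      A = \<Union>{C \<in> \<C>. C \<subseteq> A} \<Longrightarrow> emeasure \<mu> (cylinder \<C> m) = emeasure \<nu> (cylinder \<C> m)"
  shows "\<mu> = \<nu>"
proof -
  \<comment> \<open>\<open>F\<close> is a set of constraints "the count in \<open>B\<close> is
    \<open>k\<close>". The sets \<open>B\<close> may overlap, so intersecting events amounts to
    uniting constraint sets, and the events with finite \<open>F\<close> form a pi-system.\<close>
  define ev :: "('a set \<times> nat) set \<Rightarrow> 'a set set" where
    "ev F = {S \<in> configurations. \<forall>(B, k)\<in>F. card (S \<inter> B) = k}" for F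
  define adm where "adm F \<longleftrightarrow> finite F \<and> (\<forall>B\<in>fst ` F. B \<in> sets borel \<and> bounded B)"
    for F :: "('a set \<times> nat) set"
  define E where "E = {ev F | F. adm F}"
  have ev_Int: "ev F \<inter> ev F' = ev (F \<union> F')" and adm_Un: "adm F \<Longrightarrow> adm F' \<Longrightarrow> adm (F \<union> F')" for F F'
    by (auto simp: ev_def adm_def ball_Un)
  have ev_sets: "ev F \<in> sets configuration_space" if "adm F" for F
  proof -
    have "Measurable.pred configuration_space (\<lambda>S. \<forall>p\<in>F. card (S \<inter> fst p) = snd p)"
    proof (rule pred_intros_finite(3))
      show "finite F" using that by (simp add: adm_def)
      fix p assume "p \<in> F"
      then have [measurable]: "(\<lambda>S. card (S \<inter> fst p)) \<in> configuration_space \<rightarrow>\<^sub>M count_space UNIV"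
        using that by (intro measurable_card_Int) (auto simp: adm_def)
      show "Measurable.pred configuration_space (\<lambda>S. card (S \<inter> fst p) = snd p)"
        by measurable
    qed
    then show ?thesis
      by (simp add: pred_def ev_def case_prod_beta)
  qed
  have sigma: "sets configuration_space = sigma_sets configurations E"
  proof
    have "{{S \<in> configurations. card (S \<inter> B) = k} | B k. B \<in> sets borel \<and> bounded B} \<subseteq> E"
    proof safe
      fix B :: "'a set" and k assume "B \<in> sets borel" "bounded B"
      then have "{S \<in> configurations. card (S \<inter> B) = k} = ev {(B, k)}" "adm {(B, k)}"
        by (auto simp: ev_def adm_def)
      then show "{S \<in> configurations. card (S \<inter> B) = k} \<in> E" by (auto simp: E_def)
    qed
    then show "sets configuration_space \<subseteq> sigma_sets configurations E"
      unfolding sets_configuration_space by (rule sigma_sets_mono')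
    show "sigma_sets configurations E \<subseteq> sets configuration_space"
      using sets.sigma_sets_subset[of E configuration_space] ev_sets by (auto simp: E_def)
  qed
  have agree: "emeasure \<mu> X = emeasure \<nu> X" if "X \<in> E" for X
  proof -
    from that obtain F where F: "adm F" and X: "X = ev F" by (auto simp: E_def)
    obtain \<C> where \<C>: "finite \<C>" "disjoint \<C>" "\<And>C. C \<in> \<C> \<Longrightarrow> C \<in> sets borel \<and> bounded C"
      and cover: "\<And>B. B \<in> insert A (fst ` F) \<Longrightarrow> B = \<Union>{C \<in> \<C>. C \<subseteq> B}"
      using finite_disjoint_refinement[of "insert A (fst ` F)"] F A by (auto simp: adm_def)
    \<comment> \<open>\<open>W\<close> lists the count vectors on the cells that satisfy all
      constraints in \<open>F\<close>. Taking them extensional makes \<open>W\<close> countable and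
      makes distinct vectors differ on some cell, so \<open>ev F\<close> is a countable disjoint
      union of cylinders.\<close>
    define W where "W = {m \<in> \<C> \<rightarrow>\<^sub>E (UNIV :: nat set). \<forall>(B, k)\<in>F. (\<Sum>C\<in>{C \<in> \<C>. C \<subseteq> B}. m C) = k}"
    have card_eq: "card (S \<inter> B) = (\<Sum>C\<in>{C \<in> \<C>. C \<subseteq> B}. card (S \<inter> C))"
      if S: "S \<in> configurations" and B: "B \<in> fst ` F" for S B
    proof -
      have "S \<inter> B = (\<Union>C\<in>{C \<in> \<C>. C \<subseteq> B}. S \<inter> C)"
        using cover[of B] B by blast
      also have "card \<dots> = (\<Sum>C\<in>{C \<in> \<C>. C \<subseteq> B}. card (S \<inter> C))"
        using \<C> S by (intro card_UN_disjoint) (auto simp: finite_configuration_Int disjoint_def)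
      finally show ?thesis .
    qed
    have ev_UN: "ev F = (\<Union>m\<in>W. cylinder \<C> m)"
    proof (intro equalityI subsetI)
      fix S assume S: "S \<in> ev F"
      let ?m = "restrict (\<lambda>C. card (S \<inter> C)) \<C>"
      have "S \<in> cylinder \<C> ?m" using S by (auto simp: ev_def cylinder_def)
      moreover have "?m \<in> W"
      proof -
        have "(\<Sum>C\<in>{C \<in> \<C>. C \<subseteq> B}. ?m C) = k" if "(B, k) \<in> F" for B k
        proof -
          have "(\<Sum>C\<in>{C \<in> \<C>. C \<subseteq> B}. ?m C) = (\<Sum>C\<in>{C \<in> \<C>. C \<subseteq> B}. card (S \<inter> C))"
            by (rule sum.cong) auto
          also have "\<dots> = card (S \<inter> B)"
            using S that by (intro card_eq[symmetric]) (force simp: ev_def)+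
          finally show ?thesis
            using S that by (auto simp: ev_def)
        qed
        then show ?thesis by (auto simp: W_def)
      qed
      ultimately show "S \<in> (\<Union>m\<in>W. cylinder \<C> m)" by blast
    next
      fix S assume "S \<in> (\<Union>m\<in>W. cylinder \<C> m)"
      then obtain m where m: "m \<in> W" and S: "S \<in> configurations" "\<And>C. C \<in> \<C> \<Longrightarrow> card (S \<inter> C) = m C"
        by (auto simp: cylinder_def)
      have "card (S \<inter> B) = k" if "(B, k) \<in> F" for B k
      proof -
        have "card (S \<inter> B) = (\<Sum>C\<in>{C \<in> \<C>. C \<subseteq> B}. m C)"
          using card_eq[of S B] S(1) that by (simp add: S(2) rev_image_eqI cong: conj_cong)
        then show ?thesis using m that by (auto simp: W_def)
      qed
      then show "S \<in> ev F" using S by (auto simp: ev_def)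
    qed
    have "countable W"
      unfolding W_def using \<C>(1) by (intro countable_subset[OF _ countable_PiE[of \<C> "\<lambda>_. UNIV :: nat set"]]) auto
    moreover have "disjoint_family_on (cylinder \<C>) W"
      unfolding disjoint_family_on_def
    proof (intro ballI impI)
      fix m m' assume "m \<in> W" "m' \<in> W" "m \<noteq> m'"
      then have "m \<in> extensional \<C>" "m' \<in> extensional \<C>" by (auto simp: W_def PiE_def)
      with \<open>m \<noteq> m'\<close> obtain C where "C \<in> \<C>" "m C \<noteq> m' C" by (meson extensionalityI)
      then show "cylinder \<C> m \<inter> cylinder \<C> m' = {}" by (auto simp: cylinder_def)
    qed
    moreover have "cylinder \<C> m \<in> sets configuration_space" for m
      using \<C> by (intro sets_cylinder) auto
    ultimately have UN: "emeasure \<kappa> X = (\<integral>\<^sup>+m. emeasure \<kappa> (cylinder \<C> m) \<partial>count_space W)"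
      if "sets \<kappa> = sets configuration_space" for \<kappa>
      unfolding X ev_UN using that by (intro emeasure_UN_countable) auto
    have "emeasure \<mu> (cylinder \<C> m) = emeasure \<nu> (cylinder \<C> m)" for m
      by (rule eq[OF \<C>(1,2)]) (use \<C>(3) in blast, rule cover, simp)
    then show ?thesis
      by (simp add: UN sets)
  qed
  show ?thesis
  proof (rule measure_eqI_generator_eq[where A = "\<lambda>_. configurations" and \<Omega> = configurations and E = E])
    show "Int_stable E"
      unfolding Int_stable_def E_def using ev_Int adm_Un by blast
    show "E \<subseteq> Pow configurations" by (auto simp: E_def ev_def)
    have "configurations = ev {}" "adm {}" by (auto simp: ev_def adm_def)
    then show "range (\<lambda>_::nat. configurations) \<subseteq> E" unfolding E_def by blast
  qed (use sets sigma agree fin in \<open>simp_all\<close>)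
qed

section \<open>Poisson laws and the Mecke formula\<close>

text \<open>The expectations depend only on laws, so the random set is replaced by its law on
  \<open>configuration_space\<close>, described on the cylinders that determine it.\<close>

locale poisson_law = prob_space Q for Q :: "'a::euclidean_space set measure" +
  fixes d :: real
  assumes d_nonneg: "d \<ge> 0"
    and sets_Q [measurable_cong]: "sets Q = sets configuration_space"
    and prob_cylinder: "finite \<C> \<Longrightarrow> disjoint \<C> \<Longrightarrow> (\<And>C. C \<in> \<C> \<Longrightarrow> C \<in> sets borel \<and> bounded C) \<Longrightarrow>
      measure Q (cylinder \<C> m) =
        (\<Prod>C\<in>\<C>. (d * measure lborel C) ^ m C / fact (m C) * exp (- (d * measure lborel C)))"

lemma poisson_law_distr:
  fixes P :: "'w \<Rightarrow> 'a::euclidean_space set"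
  assumes M: "prob_space M" and "d \<ge> 0" and P: "homogeneous_poisson_process M d P"
  shows "poisson_law (distr M configuration_space P) d"
proof -
  interpret prob_space M by fact
  have [measurable]: "P \<in> M \<rightarrow>\<^sub>M configuration_space"
    using P by (simp add: homogeneous_poisson_process_def)
  interpret Q: prob_space "distr M configuration_space P"
    by (rule prob_space_distr) simp
  show ?thesis
  proof
    fix \<C> :: "'a set set" and m
    assume \<C>: "finite \<C>" "disjoint \<C>" and borel: "\<And>C. C \<in> \<C> \<Longrightarrow> C \<in> sets borel \<and> bounded C"
    obtain e and n :: nat where e: "bij_betw e {..<n} \<C>"
      using ex_bij_betw_nat_finite[OF \<C>(1)] by (auto simp: atLeast0LessThan)
    \<comment> \<open>Independence is available for sequences of disjoint sets, so the finite family
      is padded with empty sets.\<close>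
    define B where "B i = (if i < n then e i else {})" for i
    have B: "B i \<in> sets borel \<and> bounded (B i)" for i
      using borel e by (auto simp: B_def bij_betw_def)
    have "disjoint_family B"
      unfolding disjoint_family_on_def
    proof (intro ballI impI)
      fix i j :: nat assume "i \<noteq> j"
      then have "e i \<noteq> e j" "e i \<in> \<C>" "e j \<in> \<C>" if "i < n" "j < n"
        using e that by (auto simp: bij_betw_def inj_on_def)
      then show "B i \<inter> B j = {}"
        using disjointD[OF \<C>(2)] by (auto simp: B_def)
    qed
    then have indep: "indep_vars (\<lambda>_. count_space UNIV) (\<lambda>i \<omega>. card (P \<omega> \<inter> B i)) UNIV"
      using P B by (simp add: homogeneous_poisson_process_def)
    have single: "prob ((\<lambda>\<omega>. card (P \<omega> \<inter> B i)) -` {k} \<inter> space M) =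
        (d * measure lborel (B i)) ^ k / fact k * exp (- (d * measure lborel (B i)))" for i k
    proof -
      have "(\<lambda>\<omega>. card (P \<omega> \<inter> B i)) -` {k} \<inter> space M = {\<omega> \<in> space M. card (P \<omega> \<inter> B i) = k}"
        by auto
      then show ?thesis
        using P B[of i] by (simp add: homogeneous_poisson_process_def)
    qed
    have "cylinder \<C> m \<in> sets configuration_space"
      using \<C> borel by (intro sets_cylinder) auto
    then have eq: "measure (distr M configuration_space P) (cylinder \<C> m) = prob (P -` cylinder \<C> m \<inter> space M)"
      by (simp add: measure_distr)
    show "measure (distr M configuration_space P) (cylinder \<C> m) =
        (\<Prod>C\<in>\<C>. (d * measure lborel C) ^ m C / fact (m C) * exp (- (d * measure lborel C)))"
    proof (cases "\<C> = {}")
      \<comment> \<open>Treated separately because an intersection over no indices would be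
        \<open>UNIV\<close> instead of \<open>space M\<close>.\<close>
      case True
      then have "cylinder \<C> m = space (distr M configuration_space P)"
        by (simp add: cylinder_def)
      then show ?thesis
        using True Q.prob_space by simp
    next
      case False
      have "P -` cylinder \<C> m \<inter> space M =
          (\<Inter>i\<in>{..<n}. (\<lambda>\<omega>. card (P \<omega> \<inter> B i)) -` {m (B i)} \<inter> space M)"
      proof -
        have "P \<omega> \<in> configurations" if "\<omega> \<in> space M" for \<omega>
          using that measurable_space[of P M configuration_space] by simp
        moreover have "(\<forall>C\<in>\<C>. \<phi> C) \<longleftrightarrow> (\<forall>i\<in>{..<n}. \<phi> (B i))" for \<phi>
          using e by (auto simp: B_def bij_betw_def)
        moreover have "n > 0"
          using False e by (auto simp: bij_betw_def intro: Nat.gr0I)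
        ultimately show ?thesis
          by (auto simp: cylinder_def)
      qed
      also have "prob \<dots> = (\<Prod>i\<in>{..<n}. prob ((\<lambda>\<omega>. card (P \<omega> \<inter> B i)) -` {m (B i)} \<inter> space M))"
        using False e by (intro indep_varsD[OF indep]) (auto simp: bij_betw_def)
      also have "\<dots> = (\<Prod>i\<in>{..<n}. (d * measure lborel (e i)) ^ m (e i) / fact (m (e i)) * exp (- (d * measure lborel (e i))))"
        by (intro prod.cong refl) (simp only: single, simp add: B_def)
      also have "\<dots> = (\<Prod>C\<in>\<C>. (d * measure lborel C) ^ m C / fact (m C) * exp (- (d * measure lborel C)))"
        by (rule prod.reindex_bij_betw[OF e])
      finally show ?thesis
        by (simp add: eq)
    qed
  qed (use assms in simp_all)
qed

section \<open>Point reflections of sets and configurations\<close>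

lemma distr_lborel_reflect: "distr lborel borel (\<lambda>y. x - y) = (lborel :: 'a::euclidean_space measure)"
  using lborel_affine[of "-1" x] by (simp add: density_1)

lemma measure_lborel_reflect:
  fixes C :: "'a::euclidean_space set"
  assumes C: "C \<in> sets borel"
  shows "(\<lambda>y. x - y) ` C \<in> sets borel" "measure lborel ((\<lambda>y. x - y) ` C) = measure lborel C"
proof -
  have vim: "(\<lambda>y. x - y) ` C = (\<lambda>y. x - y) -` C \<inter> space borel"
    by (auto simp: image_iff) (metis add_diff_cancel_left' diff_add_cancel)
  show "(\<lambda>y. x - y) ` C \<in> sets borel"
    unfolding vim using C by (intro measurable_sets[of _ borel borel]) simp_all
  have "measure lborel C = measure (distr lborel borel (\<lambda>y. x - y)) C"
    by (simp add: distr_lborel_reflect)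
  also have "\<dots> = measure lborel ((\<lambda>y. x - y) ` C)"
    using C by (subst measure_distr) (auto simp: vim)
  finally show "measure lborel ((\<lambda>y. x - y) ` C) = measure lborel C" ..
qed

lemma bounded_reflect: "bounded ((\<lambda>y. x - y) ` C)" if "bounded (C :: 'a::euclidean_space set)"
proof -
  have "(\<lambda>y. x - y) ` C = (\<lambda>y. x + y) ` uminus ` C"
    by (simp add: image_image)
  then show ?thesis
    using that by (simp add: bounded_translation)
qed

text \<open>The reflection is an involution, so the test set moves inside the image. Counts of the
  reflected configuration thereby become counts of the original one in a reflected set.\<close>

lemma reflect_Int: "(\<lambda>y. x - y) ` S \<inter> C = (\<lambda>y. x - y) ` (S \<inter> (\<lambda>y. x - y) ` (C :: 'a::euclidean_space set))"
  by (auto simp: image_iff) (metis add_diff_cancel_left' diff_diff_eq2)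

lemma reflect_configurations:
  "(\<lambda>y. x - y) ` S \<in> configurations" if "S \<in> configurations" for S :: "'a::euclidean_space set"
  using that bounded_reflect[of _ x] by (auto simp: configurations_def reflect_Int)

lemma card_reflect_Int:
  "card ((\<lambda>y. x - y) ` S \<inter> C) = card (S \<inter> (\<lambda>y. x - y) ` (C :: 'a::euclidean_space set))"
  unfolding reflect_Int[of x S C] by (intro card_image) (auto simp: inj_on_def)

lemma measurable_reflect_configuration [measurable]:
  "(`) (\<lambda>y. x - y) \<in> configuration_space \<rightarrow>\<^sub>M (configuration_space :: 'a::euclidean_space set measure)"
proof (rule measurable_configuration_space)
  fix B :: "'a set" assume B: "B \<in> sets borel" "bounded B"
  have "(\<lambda>S. card (S \<inter> (\<lambda>y. x - y) ` B)) \<in> configuration_space \<rightarrow>\<^sub>M count_space UNIV"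
    using B by (intro measurable_card_Int measure_lborel_reflect bounded_reflect)
  then show "(\<lambda>S. card ((\<lambda>y. x - y) ` S \<inter> B)) \<in> configuration_space \<rightarrow>\<^sub>M count_space UNIV"
    by (simp only: card_reflect_Int)
qed (simp add: reflect_configurations)

context poisson_law
begin

lemma space_Q [simp]: "space Q = configurations"
  using sets_eq_imp_space_eq[OF sets_Q] by simp

lemma emeasure_cylinder:
  assumes "finite \<C>" "disjoint \<C>" "\<And>C. C \<in> \<C> \<Longrightarrow> C \<in> sets borel \<and> bounded C"
  shows "emeasure Q (cylinder \<C> m) =
    ennreal (\<Prod>C\<in>\<C>. (d * measure lborel C) ^ m C / fact (m C) * exp (- (d * measure lborel C)))"
  using prob_cylinder[OF assms] by (simp add: emeasure_eq_measure)

lemma void_probability: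
  assumes "B \<in> sets borel" "bounded B"
  shows "emeasure Q {S \<in> configurations. S \<inter> B = {}} = ennreal (exp (- (d * measure lborel B)))"
proof -
  have "{S \<in> configurations. S \<inter> B = {}} = cylinder {B} (\<lambda>_. 0)"
    using assms by (auto simp: cylinder_def finite_configuration_Int)
  then show ?thesis
    using assms emeasure_cylinder[of "{B}" "\<lambda>_. 0"] by (simp add: disjoint_def)
qed

text \<open>A singleton has volume 0, hence void probability \<open>exp 0 = 1\<close>. It guarantees
  that inserting a fixed point almost surely adds a new one.\<close>

lemma AE_not_mem: "AE S in Q. x \<notin> S"
proof -
  have "prob {S \<in> configurations. S \<inter> {x} = {}} = 1"
    unfolding measure_def using void_probability[of "{x}"] by simp
  then have "AE S in Q. S \<in> {S \<in> configurations. S \<inter> {x} = {}}"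
    by (rule AE_prob_1)
  then show ?thesis
    by (rule eventually_mono) auto
qed

text \<open>A Poisson cylinder probability depends on the cells only through their volumes, which
  the reflection preserves.\<close>

lemma distr_reflect: "distr Q Q ((`) (\<lambda>y. x - y)) = Q"
proof (rule measure_eqI_cylinder[where A = "{}"])
  fix \<C> :: "'a set set" and m
  assume \<C>: "finite \<C>" "disjoint \<C>" "\<And>C. C \<in> \<C> \<Longrightarrow> C \<in> sets borel \<and> bounded C"
  let ?T = "\<lambda>y. x - y"
  let ?\<C> = "(`) ?T ` \<C>"
  have TT: "?T ` ?T ` C = C" for C
    by (simp add: image_image)
  have inj: "inj_on ((`) ?T) \<C>"
    by (metis TT inj_onI)
  have "emeasure (distr Q Q ((`) ?T)) (cylinder \<C> m) = emeasure Q ((`) ?T -` cylinder \<C> m \<inter> space Q)"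
    using \<C> sets_Q by (intro emeasure_distr) (auto intro: sets_cylinder)
  \<comment> \<open>Pulling back reflects the cells; the prescribed counts are relabelled through
    the involution.\<close>
  also have "(`) ?T -` cylinder \<C> m \<inter> space Q = cylinder ?\<C> (\<lambda>C. m (?T ` C))"
    by (auto simp: cylinder_def card_reflect_Int TT reflect_configurations)
  also have "emeasure Q \<dots> = ennreal (\<Prod>C\<in>?\<C>. (d * measure lborel C) ^ m (?T ` C) / fact (m (?T ` C)) * exp (- (d * measure lborel C)))"
  proof (rule emeasure_cylinder)
    show "disjoint ?\<C>"
    proof (rule disjointI)
      fix X Y assume "X \<in> ?\<C>" "Y \<in> ?\<C>" "X \<noteq> Y"
      then obtain C D where "X = ?T ` C" "Y = ?T ` D" "C \<inter> D = {}"
        using disjointD[OF \<C>(2)] by blast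
      then show "X \<inter> Y = {}"
        by auto
    qed
  qed (use \<C> in \<open>auto simp: measure_lborel_reflect bounded_reflect\<close>)
  also have "\<dots> = emeasure Q (cylinder \<C> m)"
    using \<C> by (subst prod.reindex[OF inj]) (simp add: TT measure_lborel_reflect emeasure_cylinder)
  finally show "emeasure (distr Q Q ((`) ?T)) (cylinder \<C> m) = emeasure Q (cylinder \<C> m)" .
next
  show "emeasure (distr Q Q ((`) (\<lambda>y. x - y))) configurations \<noteq> \<infinity>"
  proof -
    interpret D: prob_space "distr Q Q ((`) (\<lambda>y. x - y))"
      by (rule prob_space_distr) simp
    show ?thesis using D.emeasure_finite by simp
  qed
qed (use sets_Q in auto)

text \<open>Almost surely \<open>x\<close> is new, and by disjointness it raises the count of
  \<open>C\<close> alone; so the count there must have been one less before. The case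
  \<open>m C = 0\<close> is split off because subtraction on naturals truncates.\<close>

lemma emeasure_insert_cylinder:
  assumes \<C>: "finite \<C>" "disjoint \<C>" "\<And>C. C \<in> \<C> \<Longrightarrow> C \<in> sets borel \<and> bounded C"
    and C: "C \<in> \<C>" "x \<in> C"
  shows "emeasure Q {S \<in> configurations. insert x S \<in> cylinder \<C> m} =
    (if m C = 0 then 0 else emeasure Q (cylinder \<C> (m(C := m C - 1))))"
proof -
  have iff: "insert x S \<in> cylinder \<C> m \<longleftrightarrow> m C \<noteq> 0 \<and> S \<in> cylinder \<C> (m(C := m C - 1))"
    if S: "S \<in> configurations" "x \<notin> S" for S
  proof -
    have "card (insert x S \<inter> D) = (if D = C then Suc (card (S \<inter> D)) else card (S \<inter> D))" if "D \<in> \<C>" for D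
    proof (cases "D = C")
      case True
      then have "finite (S \<inter> D)" using S \<C>(3) C(1) by (simp add: finite_configuration_Int)
      then show ?thesis using True S C by (simp add: Int_insert_left)
    next
      case False
      then have "x \<notin> D" using \<C>(2) C that by (auto simp: disjoint_def)
      then show ?thesis using False by (simp add: Int_insert_left)
    qed
    then show ?thesis
      using S C(1) by (auto simp: cylinder_def split: if_splits)
  qed
  have [measurable]: "cylinder \<C> m' \<in> sets configuration_space" for m'
    using \<C> by (intro sets_cylinder) auto
  have ins: "{S \<in> configurations. insert x S \<in> cylinder \<C> m} \<in> sets Q"
  proof -
    from measurable_sets[OF measurable_insert_const, of "cylinder \<C> m" x] show ?thesis
      by (simp add: sets_Q vimage_def Int_def conj_commute)
  qed
  show ?thesis
  proof (cases "m C = 0")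
    case True
    have "AE S in Q. S \<in> {S \<in> configurations. insert x S \<in> cylinder \<C> m} \<longleftrightarrow> S \<in> {}"
      using AE_not_mem[of x] by eventually_elim (use iff True in auto)
    then have "emeasure Q {S \<in> configurations. insert x S \<in> cylinder \<C> m} = emeasure Q {}"
      by (intro emeasure_eq_AE ins) auto
    then show ?thesis using True by simp
  next
    case False
    have "AE S in Q. S \<in> {S \<in> configurations. insert x S \<in> cylinder \<C> m} \<longleftrightarrow> S \<in> cylinder \<C> (m(C := m C - 1))"
      using AE_not_mem[of x] AE_space
      by eventually_elim (use iff False in \<open>auto simp: cylinder_def\<close>)
    then have "emeasure Q {S \<in> configurations. insert x S \<in> cylinder \<C> m} = emeasure Q (cylinder \<C> (m(C := m C - 1)))"
      by (intro emeasure_eq_AE ins) (auto simp: sets_Q)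
    then show ?thesis using False by simp
  qed
qed

text \<open>Rests on the identity \<open>\<mu> * (\<mu> ^ (k - 1) / fact (k - 1)) = k * (\<mu> ^ k / fact k)\<close>.\<close>

lemma emeasure_insert_cylinder_weighted:
  assumes \<C>: "finite \<C>" "disjoint \<C>" "\<And>C. C \<in> \<C> \<Longrightarrow> C \<in> sets borel \<and> bounded C"
    and C: "C \<in> \<C>"
  shows "ennreal d * emeasure lborel C * (if m C = 0 then 0 else emeasure Q (cylinder \<C> (m(C := m C - 1)))) =
    of_nat (m C) * emeasure Q (cylinder \<C> m)"
proof (cases "m C")
  case (Suc k)
  define p where "p m' C = (d * measure lborel C) ^ m' C / fact (m' C) * exp (- (d * measure lborel C))"
    for m' :: "'a set \<Rightarrow> nat" and C :: "'a set"
  let ?R = "\<Prod>D\<in>\<C> - {C}. p m D"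
  \<comment> \<open>Lowering the count of \<open>C\<close> leaves the Poisson factors of the other
    cells unchanged, so only the factor of \<open>C\<close> has to be compared.\<close>
  have R: "(\<Prod>D\<in>\<C> - {C}. p (m(C := k)) D) = ?R"
    by (rule prod.cong) (auto simp: p_def)
  have nonneg: "0 \<le> p m' D" for m' D
    using d_nonneg by (simp add: p_def)
  have cyl: "emeasure Q (cylinder \<C> m') = ennreal (\<Prod>D\<in>\<C>. p m' D)" for m'
    using emeasure_cylinder[OF \<C>] by (simp add: p_def)
  have "emeasure lborel C = ennreal (measure lborel C)"
    using \<C>(3)[OF C] emeasure_bounded_finite[of C] by (intro emeasure_eq_ennreal_measure) auto
  then have "ennreal d * emeasure lborel C * emeasure Q (cylinder \<C> (m(C := k))) =
      ennreal (d * measure lborel C * (p (m(C := k)) C * ?R))"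
    using d_nonneg nonneg
    by (simp add: cyl prod.remove[OF \<C>(1) C] R ennreal_mult[symmetric] prod_nonneg)
  also have "d * measure lborel C * (p (m(C := k)) C * ?R) = real (Suc k) * (p m C * ?R)"
    using Suc by (simp add: p_def divide_simps)
  also have "ennreal \<dots> = of_nat (m C) * emeasure Q (cylinder \<C> m)"
    using Suc nonneg by (simp add: cyl prod.remove[OF \<C>(1) C] ennreal_mult prod_nonneg ennreal_of_nat_eq_real_of_nat del: of_nat_Suc)
  finally show ?thesis using Suc by (simp add: fun_upd_def)
qed simp

text \<open>The mean measure of the process restricted to a window; for bounded \<open>A\<close> it
  is finite, as uniqueness arguments need.\<close>

definition intensity :: "'a set \<Rightarrow> 'a measure" where
  "intensity A = density lborel (\<lambda>x. ennreal d * indicator A x)"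

lemma sets_intensity [measurable_cong]: "sets (intensity A) = sets borel"
  by (simp add: intensity_def)

lemma emeasure_distr_insert:
  assumes [measurable]: "A \<in> sets borel" "X \<in> sets (borel \<Otimes>\<^sub>M configuration_space)"
  shows "emeasure (distr (intensity A \<Otimes>\<^sub>M Q) (borel \<Otimes>\<^sub>M configuration_space) (\<lambda>(x, S). (x, insert x S))) X =
    (\<integral>\<^sup>+x. ennreal d * indicator A x * emeasure Q {S \<in> configurations. (x, insert x S) \<in> X} \<partial>lborel)"
proof -
  let ?Y = "(\<lambda>(x, S). (x, insert x S)) -` X \<inter> space (intensity A \<Otimes>\<^sub>M Q)"
  have sets: "sets (intensity A \<Otimes>\<^sub>M Q) = sets (borel \<Otimes>\<^sub>M configuration_space)"
    by (intro sets_pair_measure_cong sets_intensity sets_Q)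
  have meas': "(\<lambda>(x, S). (x, insert x S)) \<in> intensity A \<Otimes>\<^sub>M Q \<rightarrow>\<^sub>M borel \<Otimes>\<^sub>M (configuration_space :: 'a set measure)"
    using measurable_case_Pair_insert measurable_cong_sets[OF sets refl] by blast
  then have Y: "?Y \<in> sets (intensity A \<Otimes>\<^sub>M Q)"
    by (rule measurable_sets) simp
  have "emeasure (distr (intensity A \<Otimes>\<^sub>M Q) (borel \<Otimes>\<^sub>M configuration_space) (\<lambda>(x, S). (x, insert x S))) X =
      emeasure (intensity A \<Otimes>\<^sub>M Q) ?Y"
    using meas' by (rule emeasure_distr) simp
  also have "\<dots> = (\<integral>\<^sup>+x. emeasure Q (Pair x -` ?Y) \<partial>intensity A)"
    using Y by (rule emeasure_pair_measure_alt)
  also have "\<dots> = (\<integral>\<^sup>+x. emeasure Q {S \<in> configurations. (x, insert x S) \<in> X} \<partial>intensity A)"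
    by (intro nn_integral_cong arg_cong2[where f = emeasure]) (auto simp: space_pair_measure)
  also have "\<dots> = (\<integral>\<^sup>+x. ennreal d * indicator A x * emeasure Q {S \<in> configurations. (x, insert x S) \<in> X} \<partial>lborel)"
    unfolding intensity_def
  proof (rule nn_integral_density)
    have eq: "emeasure Q (Pair x -` ?Y) = emeasure Q {S \<in> configurations. (x, insert x S) \<in> X}" for x
      by (intro arg_cong2[where f = emeasure]) (auto simp: space_pair_measure intensity_def)
    from measurable_emeasure_Pair[OF Y]
    show "(\<lambda>x. emeasure Q {S \<in> configurations. (x, insert x S) \<in> X}) \<in> borel_measurable lborel"
      unfolding eq by (simp add: measurable_cong_sets[OF sets_intensity refl])
  qed simp
  finally show ?thesis .
qed

lemma emeasure_distr_insert_snd: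
  assumes A [measurable]: "A \<in> sets borel" and F [measurable]: "F \<in> sets configuration_space"
  shows "emeasure (distr (intensity A \<Otimes>\<^sub>M Q) configuration_space (\<lambda>(x, S). insert x S)) F =
    (\<integral>\<^sup>+x. ennreal d * indicator A x * emeasure Q {S \<in> configurations. insert x S \<in> F} \<partial>lborel)"
    (is "emeasure ?\<nu> F = _")
proof -
  have sets: "sets (intensity A \<Otimes>\<^sub>M Q) = sets (borel \<Otimes>\<^sub>M configuration_space)"
    by (intro sets_pair_measure_cong sets_intensity sets_Q)
  have m2: "(\<lambda>(x, S). (x, insert x S)) \<in> intensity A \<Otimes>\<^sub>M Q \<rightarrow>\<^sub>M borel \<Otimes>\<^sub>M (configuration_space :: 'a set measure)"
    using measurable_case_Pair_insert measurable_cong_sets[OF sets refl] by blast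
  have "?\<nu> = distr (distr (intensity A \<Otimes>\<^sub>M Q) (borel \<Otimes>\<^sub>M configuration_space) (\<lambda>(x, S). (x, insert x S)))
      configuration_space snd"
    by (subst distr_distr[OF _ m2]) (auto simp: comp_def case_prod_unfold)
  also have "emeasure \<dots> F = emeasure (distr (intensity A \<Otimes>\<^sub>M Q) (borel \<Otimes>\<^sub>M configuration_space) (\<lambda>(x, S). (x, insert x S)))
      (snd -` F \<inter> space (borel \<Otimes>\<^sub>M configuration_space))"
    by (subst emeasure_distr) auto
  also have "\<dots> = (\<integral>\<^sup>+x. ennreal d * indicator A x *
      emeasure Q {S \<in> configurations. (x, insert x S) \<in> snd -` F \<inter> space (borel \<Otimes>\<^sub>M configuration_space)} \<partial>lborel)"
    using A by (intro emeasure_distr_insert) auto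
  also have "\<dots> = (\<integral>\<^sup>+x. ennreal d * indicator A x * emeasure Q {S \<in> configurations. insert x S \<in> F} \<partial>lborel)"
    by (intro nn_integral_cong arg_cong2[where f = "(*)"] refl arg_cong2[where f = emeasure])
       (auto simp: space_pair_measure)
  finally show ?thesis .
qed

text \<open>The Mecke formula in a fixed window for functions of the configuration alone. A point
  inserted in a cell \<open>C\<close> lowers the required count there, and by the weighted Poisson
  identity the cell contributes \<open>m C\<close> times the cylinder probability; summed over the
  cells of \<open>A\<close>, these factors give the number of points in \<open>A\<close>.\<close>

lemma density_card_eq:
  assumes A: "A \<in> sets borel" "bounded A"
  shows "density Q (\<lambda>S. of_nat (card (S \<inter> A))) =
    distr (intensity A \<Otimes>\<^sub>M Q) configuration_space (\<lambda>(x, S). insert x S)" (is "?\<mu> = ?\<nu>")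
proof (rule sym, rule measure_eqI_cylinder[OF _ _ _ A])
  have [measurable]: "(\<lambda>S. card (S \<inter> A)) \<in> configuration_space \<rightarrow>\<^sub>M count_space UNIV"
    using A by (rule measurable_card_Int)
  note nu = emeasure_distr_insert_snd[OF A(1)]
  \<comment> \<open>The equation was reversed so that finiteness is demanded of the insertion side,
    whose mass is simply \<open>d\<close> times the volume of \<open>A\<close>.\<close>
  show "emeasure ?\<nu> configurations \<noteq> \<infinity>"
  proof -
    have "{S \<in> configurations. insert x S \<in> configurations} = configurations" for x :: 'a
      by auto
    then have "emeasure ?\<nu> configurations = ennreal d * emeasure lborel A"
      using A emeasure_space_1 sets.top[of "configuration_space :: 'a set measure"]
      by (subst nu) (auto intro: nn_integral_cmult_indicator)
    then show ?thesis
      using emeasure_bounded_finite[OF A(2)] by (simp add: ennreal_mult_eq_top_iff)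
  qed
  fix \<C> :: "'a set set" and m
  assume \<C>: "finite \<C>" "disjoint \<C>" "\<And>C. C \<in> \<C> \<Longrightarrow> C \<in> sets borel \<and> bounded C"
    and cover: "A = \<Union>{C \<in> \<C>. C \<subseteq> A}"
  have cyl [measurable]: "cylinder \<C> m \<in> sets configuration_space"
    using \<C> by (intro sets_cylinder) auto
  define \<A> where "\<A> = {C \<in> \<C>. C \<subseteq> A}"
  have \<A>: "finite \<A>" "\<A> \<subseteq> \<C>" "A = \<Union>\<A>"
    using \<C>(1) cover by (auto simp: \<A>_def)
  have \<A>_borel: "C \<in> sets borel" if "C \<in> \<A>" for C
    using that \<A>(2) \<C>(3) by blast
  \<comment> \<open>The chance of reaching the counts \<open>m\<close> by inserting a point of
    \<open>C\<close>. It is the same for all points of the cell, so the integral over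
    \<open>A\<close> becomes a finite sum.\<close>
  define q where "q C = (if m C = 0 then 0 else emeasure Q (cylinder \<C> (m(C := m C - 1))))" for C
  have "emeasure ?\<nu> (cylinder \<C> m) =
      (\<integral>\<^sup>+x. ennreal d * indicator A x * emeasure Q {S \<in> configurations. insert x S \<in> cylinder \<C> m} \<partial>lborel)"
    using cyl by (rule nu)
  also have "\<dots> = (\<integral>\<^sup>+x. (\<Sum>C\<in>\<A>. ennreal d * q C * indicator C x) \<partial>lborel)"
  proof (rule nn_integral_cong)
    fix x
    show "ennreal d * indicator A x * emeasure Q {S \<in> configurations. insert x S \<in> cylinder \<C> m} =
      (\<Sum>C\<in>\<A>. ennreal d * q C * indicator C x)"
    proof (cases "x \<in> A")
      case True
      then obtain C where C: "C \<in> \<A>" "x \<in> C" using \<A>(3) by blast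
      have "x \<notin> D" if "D \<in> \<A> - {C}" for D
        using that C \<A>(2) disjointD[OF \<C>(2), of C D] by blast
      then have "(\<Sum>D\<in>\<A>. ennreal d * q D * indicator D x) = ennreal d * q C"
        using C by (simp add: sum.remove[OF \<A>(1) C(1)])
      moreover have "emeasure Q {S \<in> configurations. insert x S \<in> cylinder \<C> m} = q C"
        unfolding q_def using C \<A>(2) by (intro emeasure_insert_cylinder \<C>) auto
      ultimately show ?thesis using True by simp
    next
      case False
      then have "(\<Sum>C\<in>\<A>. ennreal d * q C * indicator C x) = 0"
        using \<A>(3) by (intro sum.neutral) auto
      then show ?thesis using False by simp
    qed
  qed
  also have "\<dots> = (\<Sum>C\<in>\<A>. ennreal d * q C * emeasure lborel C)"
    using \<A>_borel
    by (subst nn_integral_sum)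
       (auto intro!: sum.cong nn_integral_cmult_indicator borel_measurable_times_ennreal borel_measurable_indicator)
  also have "\<dots> = (\<Sum>C\<in>\<A>. of_nat (m C) * emeasure Q (cylinder \<C> m))"
  proof (intro sum.cong refl)
    fix C assume "C \<in> \<A>"
    then have "ennreal d * emeasure lborel C * q C = of_nat (m C) * emeasure Q (cylinder \<C> m)"
      unfolding q_def using \<A>(2) by (intro emeasure_insert_cylinder_weighted \<C>) auto
    then show "ennreal d * q C * emeasure lborel C = of_nat (m C) * emeasure Q (cylinder \<C> m)"
      by (simp add: mult_ac)
  qed
  also have "\<dots> = of_nat (\<Sum>C\<in>\<A>. m C) * emeasure Q (cylinder \<C> m)"
    by (simp add: sum_distrib_right)
  \<comment> \<open>On the cylinder this constant equals \<open>card (S \<inter> A)\<close>, because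
    the cells in \<open>\<A>\<close> partition \<open>A\<close>.\<close>
  also have "\<dots> = (\<integral>\<^sup>+S. of_nat (\<Sum>C\<in>\<A>. m C) * indicator (cylinder \<C> m) S \<partial>Q)"
    using cyl by (simp add: nn_integral_cmult_indicator sets_Q)
  also have "\<dots> = (\<integral>\<^sup>+S. of_nat (card (S \<inter> A)) * indicator (cylinder \<C> m) S \<partial>Q)"
  proof (rule nn_integral_cong)
    fix S assume "S \<in> space Q"
    have "card (S \<inter> A) = (\<Sum>C\<in>\<A>. m C)" if S: "S \<in> cylinder \<C> m"
    proof -
      have "S \<inter> A = (\<Union>C\<in>\<A>. S \<inter> C)" using \<A>(3) by blast
      also have "card \<dots> = (\<Sum>C\<in>\<A>. card (S \<inter> C))"
      proof (rule card_UN_disjoint)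
        show "\<forall>C\<in>\<A>. finite (S \<inter> C)"
          using S \<C>(3) \<A>(2) by (auto simp: cylinder_def finite_configuration_Int)
        show "\<forall>C\<in>\<A>. \<forall>D\<in>\<A>. C \<noteq> D \<longrightarrow> S \<inter> C \<inter> (S \<inter> D) = {}"
          using disjointD[OF \<C>(2)] \<A>(2) by blast
      qed (rule \<A>(1))
      also have "\<dots> = (\<Sum>C\<in>\<A>. m C)"
        using S \<A>(2) by (intro sum.cong refl) (auto simp: cylinder_def)
      finally show ?thesis .
    qed
    then show "of_nat (\<Sum>C\<in>\<A>. m C) * indicator (cylinder \<C> m) S =
        (of_nat (card (S \<inter> A)) * indicator (cylinder \<C> m) S :: ennreal)"
      by (cases "S \<in> cylinder \<C> m") auto
  qed
  also have "\<dots> = emeasure ?\<mu> (cylinder \<C> m)"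
    using cyl by (subst emeasure_density) (auto simp: sets_Q)
  finally show "emeasure ?\<nu> (cylinder \<C> m) = emeasure ?\<mu> (cylinder \<C> m)" .
qed (use sets_Q in simp_all)

section \<open>The Mecke formula: from indicators in a window to nonnegative functions\<close>

lemma borel_measurable_sum_self:
  fixes f :: "'a \<times> 'a set \<Rightarrow> ennreal"
  assumes "f \<in> borel_measurable (borel \<Otimes>\<^sub>M configuration_space)"
  shows "(\<lambda>S. \<integral>\<^sup>+x. f (x, S) \<partial>count_space S) \<in> borel_measurable Q"
proof -
  have "(\<lambda>S. (S, S)) \<in> configuration_space \<rightarrow>\<^sub>M configuration_space \<Otimes>\<^sub>M (configuration_space :: 'a set measure)"
    by simp
  from measurable_compose[OF this borel_measurable_sum_configuration[OF assms]]
  show ?thesis by (simp add: measurable_cong_sets[OF sets_Q refl])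
qed

lemma borel_measurable_sum_indicator_self:
  assumes "U \<in> sets borel" "bounded U" "D \<in> sets (borel \<Otimes>\<^sub>M configuration_space)"
  shows "(\<lambda>S. \<integral>\<^sup>+x. indicator D (x, S) \<partial>count_space (S \<inter> U)) \<in> borel_measurable Q"
proof -
  have "(\<lambda>S. (S, S)) \<in> configuration_space \<rightarrow>\<^sub>M configuration_space \<Otimes>\<^sub>M (configuration_space :: 'a set measure)"
    by simp
  from measurable_compose[OF this borel_measurable_sum_indicator_bounded[OF assms]]
  show ?thesis by (simp add: measurable_cong_sets[OF sets_Q refl])
qed

text \<open>Both sides are additive over disjoint unions in \<open>D\<close>, so a Dynkin argument
  extends the formula from rectangles, where it is \<open>density_card_eq\<close>.\<close>

lemma mecke_indicator:
  assumes U: "U \<in> sets borel" "bounded U"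
    and D: "D \<in> sets (borel \<Otimes>\<^sub>M configuration_space)"
  shows "(\<integral>\<^sup>+S. (\<integral>\<^sup>+x. indicator D (x, S) \<partial>count_space (S \<inter> U)) \<partial>Q) =
    (\<integral>\<^sup>+x. ennreal d * indicator U x * emeasure Q {S \<in> configurations. (x, insert x S) \<in> D} \<partial>lborel)"
proof -
  define R where "R = distr (intensity U \<Otimes>\<^sub>M Q) (borel \<Otimes>\<^sub>M configuration_space) (\<lambda>(x, S). (x, insert x S))"
  have sets_R: "sets R = sets (borel \<Otimes>\<^sub>M configuration_space)"
    by (simp add: R_def)
  have space_R: "space R = UNIV \<times> configurations"
    by (simp add: R_def space_pair_measure)
  have R: "emeasure R X = (\<integral>\<^sup>+x. ennreal d * indicator U x * emeasure Q {S \<in> configurations. (x, insert x S) \<in> X} \<partial>lborel)"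
    if "X \<in> sets (borel \<Otimes>\<^sub>M configuration_space)" for X
    unfolding R_def using U that by (intro emeasure_distr_insert)
  note meas = borel_measurable_sum_indicator_self[OF U]
  \<comment> \<open>The condition \<open>x \<in> a\<close> merely shrinks the window to
    \<open>U \<inter> a\<close>, and \<open>b\<close> is the event at which the two measures are
    compared.\<close>
  have rectangle: "(\<integral>\<^sup>+S. (\<integral>\<^sup>+x. indicator (a \<times> b) (x, S) \<partial>count_space (S \<inter> U)) \<partial>Q) = emeasure R (a \<times> b)"
    if ab [measurable]: "a \<in> sets borel" "b \<in> sets configuration_space" for a and b :: "'a set set"
  proof -
    have Ua: "U \<inter> a \<in> sets borel" "bounded (U \<inter> a)"
      using U by (auto intro: bounded_subset)
    have [measurable]: "(\<lambda>S. card (S \<inter> (U \<inter> a))) \<in> configuration_space \<rightarrow>\<^sub>M count_space UNIV"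
      using Ua by (rule measurable_card_Int)
    have "(\<integral>\<^sup>+S. (\<integral>\<^sup>+x. indicator (a \<times> b) (x, S) \<partial>count_space (S \<inter> U)) \<partial>Q) =
        (\<integral>\<^sup>+S. of_nat (card (S \<inter> (U \<inter> a))) * indicator b S \<partial>Q)"
      using U by (intro nn_integral_cong sum_indicator_rectangle finite_configuration_Int) auto
    also have "\<dots> = emeasure (density Q (\<lambda>S. of_nat (card (S \<inter> (U \<inter> a))))) b"
      by (subst emeasure_density) (auto simp: sets_Q)
    also have "\<dots> = emeasure (distr (intensity (U \<inter> a) \<Otimes>\<^sub>M Q) configuration_space (\<lambda>(x, S). insert x S)) b"
      using density_card_eq[OF Ua] by simp
    also have "\<dots> = (\<integral>\<^sup>+x. ennreal d * indicator (U \<inter> a) x * emeasure Q {S \<in> configurations. insert x S \<in> b} \<partial>lborel)"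
      using Ua ab by (intro emeasure_distr_insert_snd)
    also have "\<dots> = emeasure R (a \<times> b)"
      using ab by (subst R) (auto intro!: nn_integral_cong split: split_indicator)
    finally show ?thesis .
  qed
  \<comment> \<open>Finite mass, from the bounded window, is what lets the complement step cancel
    \<open>emeasure R X\<close>.\<close>
  have fin: "emeasure R (space R) \<noteq> \<infinity>"
  proof -
    have "{S \<in> configurations. insert x S \<in> configurations} = configurations" for x :: 'a
      by auto
    then have "emeasure R (space R) = ennreal d * emeasure lborel U"
      using U emeasure_space_1 sets.top[of "borel \<Otimes>\<^sub>M configuration_space :: ('a \<times> 'a set) measure"]
      by (subst R) (auto simp: space_R space_pair_measure intro: nn_integral_cmult_indicator)
    then show ?thesis
      using emeasure_bounded_finite[OF U(2)] by (simp add: ennreal_mult_eq_top_iff)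
  qed
  interpret R: finite_measure R
    by standard (rule fin)
  have "(\<integral>\<^sup>+S. (\<integral>\<^sup>+x. indicator D (x, S) \<partial>count_space (S \<inter> U)) \<partial>Q) = emeasure R D"
    using Int_stable_pair_measure_generator pair_measure_closed D[unfolded sets_pair_measure]
  proof (induction rule: sigma_sets_induct_disjoint)
    case (basic X)
    then show ?case using rectangle by auto
  next
    case empty
    then show ?case by simp
  next
    case (compl X)
    have X: "X \<in> sets (borel \<Otimes>\<^sub>M configuration_space)"
      using compl(1) by (simp add: sets_pair_measure)
    have sp: "space borel \<times> space configuration_space = space R"
      by (simp add: space_R)
    have X': "space R - X \<in> sets (borel \<Otimes>\<^sub>M configuration_space)"
      using X sets_R by (metis sets.compl_sets)
    have "(\<integral>\<^sup>+S. (\<integral>\<^sup>+x. indicator (space R - X) (x, S) \<partial>count_space (S \<inter> U)) \<partial>Q) +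
        (\<integral>\<^sup>+S. (\<integral>\<^sup>+x. indicator X (x, S) \<partial>count_space (S \<inter> U)) \<partial>Q) =
        (\<integral>\<^sup>+S. (\<integral>\<^sup>+x. indicator (space R - X) (x, S) + indicator X (x, S) \<partial>count_space (S \<inter> U)) \<partial>Q)"
      using meas[OF X] meas[OF X'] by (subst nn_integral_add[symmetric]) (auto intro!: nn_integral_cong nn_integral_add[symmetric])
    also have "\<dots> = (\<integral>\<^sup>+S. (\<integral>\<^sup>+x. indicator (UNIV \<times> configurations) (x, S) \<partial>count_space (S \<inter> U)) \<partial>Q)"
      by (intro nn_integral_cong) (auto simp: space_R indicator_def)
    also have "\<dots> = emeasure R (UNIV \<times> configurations)"
      using sets.top[of "configuration_space :: 'a set measure"] by (intro rectangle) auto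
    finally have "(\<integral>\<^sup>+S. (\<integral>\<^sup>+x. indicator (space R - X) (x, S) \<partial>count_space (S \<inter> U)) \<partial>Q) + emeasure R X = emeasure R (space R)"
      using compl(2) by (simp add: space_R)
    moreover have "emeasure R (space R - X) + emeasure R X = emeasure R (space R)"
      using X sets_R by (subst plus_emeasure) (auto simp: Un_absorb2 sets.sets_into_space)
    ultimately show ?case
      unfolding sp using R.emeasure_finite[of X]
      by (metis (no_types, lifting) ennreal_add_left_cancel add.commute infinity_ennreal_def)
  next
    case (union X)
    have X: "X i \<in> sets (borel \<Otimes>\<^sub>M configuration_space)" for i
      using union(2) by (auto simp: sets_pair_measure)
    have "(\<integral>\<^sup>+S. (\<integral>\<^sup>+x. indicator (\<Union>i. X i) (x, S) \<partial>count_space (S \<inter> U)) \<partial>Q) =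
        (\<integral>\<^sup>+S. (\<Sum>i. \<integral>\<^sup>+x. indicator (X i) (x, S) \<partial>count_space (S \<inter> U)) \<partial>Q)"
      using union(1) by (subst nn_integral_suminf[symmetric]) (auto simp: suminf_indicator)
    also have "\<dots> = (\<Sum>i. \<integral>\<^sup>+S. (\<integral>\<^sup>+x. indicator (X i) (x, S) \<partial>count_space (S \<inter> U)) \<partial>Q)"
      using meas[OF X] by (rule nn_integral_suminf)
    also have "\<dots> = (\<Sum>i. emeasure R (X i))"
      using union(3) by simp
    also have "\<dots> = emeasure R (\<Union>i. X i)"
      using union(1) X sets_R by (intro suminf_emeasure) auto
    finally show ?case .
  qed
  then show ?thesis
    by (simp add: R[OF D])
qed

text \<open>Over the whole space the insertion measure has infinite mass, which rules out cancelling
  complements there; the indicator case is instead the limit of the formula in growing balls.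
  Linearity and monotone limits do the rest.\<close>

lemma mecke:
  fixes f :: "'a \<times> 'a set \<Rightarrow> ennreal"
  assumes "f \<in> borel_measurable (borel \<Otimes>\<^sub>M configuration_space)"
  shows "(\<integral>\<^sup>+S. (\<integral>\<^sup>+x. f (x, S) \<partial>count_space S) \<partial>Q) =
    ennreal d * (\<integral>\<^sup>+x. (\<integral>\<^sup>+S. f (x, insert x S) \<partial>Q) \<partial>lborel)"
proof -
  have "sets (lborel \<Otimes>\<^sub>M Q) = sets (borel \<Otimes>\<^sub>M configuration_space)"
    by (intro sets_pair_measure_cong sets_lborel sets_Q)
  then have ins: "(\<lambda>(x, S). (x, insert x S)) \<in> lborel \<Otimes>\<^sub>M Q \<rightarrow>\<^sub>M borel \<Otimes>\<^sub>M (configuration_space :: 'a set measure)"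
    using measurable_case_Pair_insert measurable_cong_sets[of "lborel \<Otimes>\<^sub>M Q" "borel \<Otimes>\<^sub>M configuration_space"]
    by blast
  \<comment> \<open>As one integral over pairs, the right-hand side passes directly through the sum
    and limit steps of the induction.\<close>
  have split: "(\<integral>\<^sup>+x. (\<integral>\<^sup>+S. g (x, insert x S) \<partial>Q) \<partial>lborel) =
      (\<integral>\<^sup>+z. g z \<partial>distr (lborel \<Otimes>\<^sub>M Q) (borel \<Otimes>\<^sub>M configuration_space) (\<lambda>(x, S). (x, insert x S)))"
    if g: "g \<in> borel_measurable (borel \<Otimes>\<^sub>M configuration_space)" for g :: "'a \<times> 'a set \<Rightarrow> ennreal"
  proof -
    have "(\<lambda>z. g (case z of (x, S) \<Rightarrow> (x, insert x S))) \<in> borel_measurable (lborel \<Otimes>\<^sub>M Q)"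
      using measurable_compose[OF ins g] .
    from nn_integral_fst[OF this] show ?thesis
      using ins g by (subst nn_integral_distr) auto
  qed
  let ?R = "distr (lborel \<Otimes>\<^sub>M Q) (borel \<Otimes>\<^sub>M configuration_space) (\<lambda>(x, S). (x, insert x S))"
  have "(\<integral>\<^sup>+S. (\<integral>\<^sup>+x. f (x, S) \<partial>count_space S) \<partial>Q) = ennreal d * (\<integral>\<^sup>+z. f z \<partial>?R)"
    using assms
  proof (induction rule: borel_measurable_induct)
    case (cong f g)
    have "(\<integral>\<^sup>+S. (\<integral>\<^sup>+x. f (x, S) \<partial>count_space S) \<partial>Q) = (\<integral>\<^sup>+S. (\<integral>\<^sup>+x. g (x, S) \<partial>count_space S) \<partial>Q)"
      using cong(3) by (intro nn_integral_cong) (auto simp: space_pair_measure)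
    moreover have "(\<integral>\<^sup>+z. f z \<partial>?R) = (\<integral>\<^sup>+z. g z \<partial>?R)"
      using cong(3) by (intro nn_integral_cong) auto
    ultimately show ?case using cong(4) by simp
  next
    case (set D)
    let ?q = "\<lambda>x. emeasure Q {S \<in> configurations. (x, insert x S) \<in> D}"
    have q: "(\<integral>\<^sup>+S. indicator D (x, insert x S) \<partial>Q) = ?q x" for x
    proof -
      from measurable_sets[OF measurable_Pair_insert set]
      have "{S \<in> configurations. (x, insert x S) \<in> D} \<in> sets Q"
        by (simp add: sets_Q vimage_def Int_def conj_commute)
      then have "?q x = (\<integral>\<^sup>+S. indicator {S \<in> configurations. (x, insert x S) \<in> D} S \<partial>Q)"
        by (rule nn_integral_indicator[symmetric])
      also have "\<dots> = (\<integral>\<^sup>+S. indicator D (x, insert x S) \<partial>Q)"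
        by (intro nn_integral_cong) (simp add: indicator_def)
      finally show ?thesis ..
    qed
    have q_meas: "?q \<in> borel_measurable lborel"
    proof -
      have "(\<lambda>z. indicator D (case z of (x, S) \<Rightarrow> (x, insert x S)) :: ennreal) \<in> borel_measurable (lborel \<Otimes>\<^sub>M Q)"
        using set by (intro measurable_compose[OF ins]) simp
      from borel_measurable_nn_integral_fst[OF this] show ?thesis
        by (simp add: q)
    qed
    have "(\<integral>\<^sup>+S. (\<integral>\<^sup>+x. indicator D (x, S) \<partial>count_space S) \<partial>Q) =
        (\<integral>\<^sup>+S. (SUP n. \<integral>\<^sup>+x. indicator D (x, S) \<partial>count_space (S \<inter> ball 0 (real n))) \<partial>Q)"
      by (rule nn_integral_cong) (rule nn_integral_count_space_balls)
    also have "\<dots> = (SUP n. \<integral>\<^sup>+S. (\<integral>\<^sup>+x. indicator D (x, S) \<partial>count_space (S \<inter> ball 0 (real n))) \<partial>Q)"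
    proof (rule nn_integral_monotone_convergence_SUP)
      show "incseq (\<lambda>n S. \<integral>\<^sup>+x. indicator D (x, S) \<partial>count_space (S \<inter> ball 0 (real n)))"
      proof (intro incseq_SucI le_funI)
        fix n and S :: "'a set"
        show "(\<integral>\<^sup>+x. indicator D (x, S) \<partial>count_space (S \<inter> ball 0 (real n))) \<le>
            (\<integral>\<^sup>+x. indicator D (x, S) \<partial>count_space (S \<inter> ball 0 (real (Suc n))))"
          by (subst (1 2) nn_integral_count_space_indicator) (auto intro!: nn_integral_mono simp: indicator_def)
      qed
      show "(\<lambda>S. \<integral>\<^sup>+x. indicator D (x, S) \<partial>count_space (S \<inter> ball 0 (real n))) \<in> borel_measurable Q"
        for n :: nat
        using set by (intro borel_measurable_sum_indicator_self) auto
    qed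
    also have "\<dots> = (SUP n. \<integral>\<^sup>+x. ennreal d * indicator (ball 0 (real n)) x * ?q x \<partial>lborel)"
      using set by (intro SUP_cong refl mecke_indicator) auto
    also have "\<dots> = (\<integral>\<^sup>+x. (SUP n. ennreal d * indicator (ball 0 (real n)) x * ?q x) \<partial>lborel)"
    proof (rule nn_integral_monotone_convergence_SUP[symmetric])
      show "incseq (\<lambda>n x. ennreal d * indicator (ball 0 (real n)) x * ?q x)"
        by (intro incseq_SucI le_funI mult_mono) (auto simp: indicator_def)
      show "(\<lambda>x. ennreal d * indicator (ball 0 (real n)) x * ?q x) \<in> borel_measurable lborel" for n :: nat
        using q_meas by (intro borel_measurable_times_ennreal borel_measurable_indicator) auto
    qed
    also have "\<dots> = (\<integral>\<^sup>+x. ennreal d * ?q x \<partial>lborel)"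
    proof (rule nn_integral_cong)
      fix x :: 'a
      obtain n where "norm x < real n" using reals_Archimedean2 by blast
      then have "ennreal d * ?q x \<le> (SUP n. ennreal d * indicator (ball 0 (real n)) x * ?q x)"
        by (intro SUP_upper2[of n]) auto
      moreover have "(SUP n. ennreal d * indicator (ball 0 (real n)) x * ?q x) \<le> ennreal d * ?q x"
        by (intro SUP_least) (auto simp: indicator_def)
      ultimately show "(SUP n. ennreal d * indicator (ball 0 (real n)) x * ?q x) = ennreal d * ?q x"
        by (rule antisym[rotated])
    qed
    also have "\<dots> = ennreal d * (\<integral>\<^sup>+x. ?q x \<partial>lborel)"
      using q_meas by (rule nn_integral_cmult)
    also have "(\<integral>\<^sup>+x. ?q x \<partial>lborel) = (\<integral>\<^sup>+z. indicator D z \<partial>?R)"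
      using split[of "indicator D"] set by (simp add: q)
    finally show ?case .
  next
    case (mult u c)
    then show ?case
      using borel_measurable_sum_self[of u]
      by (simp add: nn_integral_cmult mult_ac)
  next
    case (add u v)
    then show ?case
      using borel_measurable_sum_self[of u] borel_measurable_sum_self[of v]
      by (simp add: nn_integral_add distrib_left)
  next
    case (seq V)
    have inc: "incseq V" by fact
    have "(\<integral>\<^sup>+S. (\<integral>\<^sup>+x. (SUP i. V i) (x, S) \<partial>count_space S) \<partial>Q) =
        (\<integral>\<^sup>+S. (SUP i. \<integral>\<^sup>+x. V i (x, S) \<partial>count_space S) \<partial>Q)"
      using inc unfolding SUP_apply
      by (intro nn_integral_cong nn_integral_monotone_convergence_SUP) (auto simp: incseq_def le_fun_def)
    also have "\<dots> = (SUP i. \<integral>\<^sup>+S. (\<integral>\<^sup>+x. V i (x, S) \<partial>count_space S) \<partial>Q)"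
      using seq(1) inc
      by (intro nn_integral_monotone_convergence_SUP borel_measurable_sum_self)
         (auto simp: incseq_def le_fun_def intro!: nn_integral_mono)
    also have "\<dots> = (SUP i. ennreal d * (\<integral>\<^sup>+z. V i z \<partial>?R))"
      using seq by simp
    also have "\<dots> = ennreal d * (SUP i. \<integral>\<^sup>+z. V i z \<partial>?R)"
      by (simp add: SUP_mult_left_ennreal)
    also have "(SUP i. \<integral>\<^sup>+z. V i z \<partial>?R) = (\<integral>\<^sup>+z. (SUP i. V i) z \<partial>?R)"
      using seq(1) inc unfolding SUP_apply
      by (intro nn_integral_monotone_convergence_SUP[symmetric]) auto
    finally show ?case .
  qed
  then show ?thesis
    using split[OF assms] by simp
qed

end

section \<open>A Gaussian integral outside a disc\<close>

lemma nn_integral_exp_tail: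
  fixes c t :: real
  assumes "c > 0"
  shows "(\<integral>\<^sup>+s. ennreal (c * exp (- c * s)) * indicator {t..} s \<partial>lborel) = ennreal (exp (- c * t))"
proof -
  have "(\<integral>\<^sup>+s. ennreal (c * exp (- c * s)) * indicator {t..} s \<partial>lborel) = ennreal (0 - (- exp (- c * t)))"
  proof (rule nn_integral_FTC_atLeast)
    show "((\<lambda>s. - exp (- c * s)) has_real_derivative c * exp (- c * s)) (at s)" for s
      by (auto intro!: derivative_eq_intros)
    have "((\<lambda>s. exp (- c * s)) \<longlongrightarrow> 0) at_top"
      using assms by real_asymp
    then show "((\<lambda>s. - exp (- c * s)) \<longlongrightarrow> 0) at_top"
      using tendsto_minus by fastforce
  qed (use assms in auto)
  then show ?thesis by simp
qed

text \<open>The mean of the exponential law, read off as the first moment of the Erlang density with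
  shape 0.\<close>

lemma nn_integral_linear_exp:
  fixes c :: real
  assumes "c > 0"
  shows "(\<integral>\<^sup>+s. ennreal (c * exp (- c * s)) * (ennreal s * indicator {0..} s) \<partial>lborel) = ennreal (1 / c)"
proof -
  have "(\<integral>\<^sup>+s. ennreal (c * exp (- c * s)) * (ennreal s * indicator {0..} s) \<partial>lborel) =
      (\<integral>\<^sup>+s. ennreal (erlang_density 0 c s * s ^ 1) \<partial>lborel)"
    using assms by (intro nn_integral_cong) (auto simp: erlang_density_def indicator_def ennreal_mult' mult_ac not_less)
  then show ?thesis
    using nn_integral_erlang_ith_moment[OF assms, of 0 1] by simp
qed

lemma emeasure_annulus:
  fixes a b :: real
  assumes "0 \<le> a" "a \<le> b"
  shows "emeasure lborel (cball (0::plane) b - cball 0 a) = ennreal (pi * (b\<^sup>2 - a\<^sup>2))"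
proof -
  have "emeasure lborel (cball (0::plane) b - cball 0 a) = emeasure lborel (cball (0::plane) b) - emeasure lborel (cball (0::plane) a)"
    using assms emeasure_lborel_cball_finite[of "0::plane" a]
    by (intro emeasure_Diff) auto
  also have "\<dots> = ennreal (pi * b\<^sup>2) - ennreal (pi * a\<^sup>2)"
    using assms by (simp add: emeasure_cball unit_ball_vol_2)
  also have "\<dots> = ennreal (pi * (b\<^sup>2 - a\<^sup>2))"
    using assms by (subst ennreal_minus) (auto simp: algebra_simps)
  finally show ?thesis .
qed

text \<open>Writing the exponential as a tail integral reduces the claim to the area \<open>pi * s\<close> of the
  annulus between the radii \<open>\<rho>\<close> and \<open>sqrt (\<rho>\<^sup>2 + s)\<close>.\<close>

lemma nn_integral_gaussian_outside_ball:
  fixes c \<rho> :: real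
  assumes c: "c > 0" and \<rho>: "\<rho> \<ge> 0"
  shows "(\<integral>\<^sup>+x. ennreal (exp (- c * ((norm x)\<^sup>2 - \<rho>\<^sup>2))) * indicator {x. \<rho> < norm x} x \<partial>(lborel :: plane measure)) =
    ennreal (pi / c)"
proof -
  have "(\<integral>\<^sup>+x. ennreal (exp (- c * ((norm x)\<^sup>2 - \<rho>\<^sup>2))) * indicator {x. \<rho> < norm x} x \<partial>(lborel :: plane measure)) =
      (\<integral>\<^sup>+x. (\<integral>\<^sup>+s. ennreal (c * exp (- c * s)) * (if (norm x)\<^sup>2 - \<rho>\<^sup>2 \<le> s \<and> \<rho> < norm x then 1 else 0) \<partial>lborel) \<partial>(lborel :: plane measure))"
  proof (rule nn_integral_cong)
    fix x :: plane
    show "ennreal (exp (- c * ((norm x)\<^sup>2 - \<rho>\<^sup>2))) * indicator {x. \<rho> < norm x} x =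
        (\<integral>\<^sup>+s. ennreal (c * exp (- c * s)) * (if (norm x)\<^sup>2 - \<rho>\<^sup>2 \<le> s \<and> \<rho> < norm x then 1 else 0) \<partial>lborel)"
    proof (cases "\<rho> < norm x")
      case True
      have "(\<integral>\<^sup>+s. ennreal (c * exp (- c * s)) * (if (norm x)\<^sup>2 - \<rho>\<^sup>2 \<le> s \<and> \<rho> < norm x then 1 else 0) \<partial>lborel) =
          (\<integral>\<^sup>+s. ennreal (c * exp (- c * s)) * indicator {(norm x)\<^sup>2 - \<rho>\<^sup>2..} s \<partial>lborel)"
        using True by (intro nn_integral_cong) (auto simp: indicator_def)
      then show ?thesis
        using True nn_integral_exp_tail[OF c] by simp
    qed simp
  qed
  also have "\<dots> = (\<integral>\<^sup>+s. (\<integral>\<^sup>+x. ennreal (c * exp (- c * s)) * (if (norm x)\<^sup>2 - \<rho>\<^sup>2 \<le> s \<and> \<rho> < norm x then 1 else 0) \<partial>(lborel :: plane measure)) \<partial>lborel)"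
  proof (rule pair_sigma_finite.Fubini'[symmetric, OF pair_sigma_finite.intro])
    show "(\<lambda>(x, s). ennreal (c * exp (- c * s)) * (if (norm x)\<^sup>2 - \<rho>\<^sup>2 \<le> s \<and> \<rho> < norm x then 1 else 0))
        \<in> borel_measurable ((lborel :: plane measure) \<Otimes>\<^sub>M lborel)"
      by measurable
  qed (rule lborel.sigma_finite_measure_axioms)+
  \<comment> \<open>For \<open>s < 0\<close> no \<open>x\<close> with \<open>\<rho> < norm x\<close>
    qualifies; this produces the restriction to \<open>{0..}\<close>.\<close>
  also have "\<dots> = (\<integral>\<^sup>+s. ennreal pi * (ennreal (c * exp (- c * s)) * (ennreal s * indicator {0..} s)) \<partial>lborel)"
  proof (rule nn_integral_cong)
    fix s :: real
    let ?A = "{x :: plane. (norm x)\<^sup>2 - \<rho>\<^sup>2 \<le> s \<and> \<rho> < norm x}"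
    have A: "?A \<in> sets lborel" by measurable
    have "emeasure lborel ?A = ennreal pi * (ennreal s * indicator {0..} s)"
    proof (cases "s \<ge> 0")
      case True
      have "?A = cball 0 (sqrt (\<rho>\<^sup>2 + s)) - cball 0 \<rho>"
      proof -
        have "(norm x)\<^sup>2 - \<rho>\<^sup>2 \<le> s \<longleftrightarrow> norm x \<le> sqrt (\<rho>\<^sup>2 + s)" for x :: plane
        proof -
          have "norm x \<le> sqrt (\<rho>\<^sup>2 + s) \<longleftrightarrow> sqrt ((norm x)\<^sup>2) \<le> sqrt (\<rho>\<^sup>2 + s)"
            by simp
          also have "\<dots> \<longleftrightarrow> (norm x)\<^sup>2 \<le> \<rho>\<^sup>2 + s"
            by (rule real_sqrt_le_iff)
          finally show ?thesis by linarith
        qed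
        then show ?thesis
          by (intro set_eqI) (simp add: not_le)
      qed
      moreover have "\<rho> \<le> sqrt (\<rho>\<^sup>2 + s)"
        using True by (intro real_le_rsqrt) simp
      ultimately have "emeasure lborel ?A = ennreal (pi * ((sqrt (\<rho>\<^sup>2 + s))\<^sup>2 - \<rho>\<^sup>2))"
        using \<rho> emeasure_annulus by simp
      then show ?thesis
        using True by (simp add: ennreal_mult)
    next
      case False
      have "\<rho>\<^sup>2 < (norm x)\<^sup>2" if "\<rho> < norm x" for x :: plane
        using that \<rho> by (intro power_strict_mono) auto
      then have empty: "?A = {}"
        using False by force
      show ?thesis unfolding empty using False by simp
    qed
    moreover have "(\<integral>\<^sup>+x. ennreal (c * exp (- c * s)) * (if (norm x)\<^sup>2 - \<rho>\<^sup>2 \<le> s \<and> \<rho> < norm x then 1 else 0) \<partial>(lborel :: plane measure)) =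
        ennreal (c * exp (- c * s)) * emeasure lborel ?A"
      using nn_integral_cmult_indicator[OF A, of "ennreal (c * exp (- c * s))"]
      by (simp add: indicator_def of_bool_def)
    ultimately show "(\<integral>\<^sup>+x. ennreal (c * exp (- c * s)) * (if (norm x)\<^sup>2 - \<rho>\<^sup>2 \<le> s \<and> \<rho> < norm x then 1 else 0) \<partial>(lborel :: plane measure)) =
        ennreal pi * (ennreal (c * exp (- c * s)) * (ennreal s * indicator {0..} s))"
      by (simp add: mult_ac)
  qed
  also have "\<dots> = ennreal pi * ennreal (1 / c)"
    by (subst nn_integral_cmult) (auto simp: nn_integral_linear_exp[OF c, simplified] )
  also have "\<dots> = ennreal (pi / c)"
    using c by (simp add: ennreal_mult[symmetric])
  finally show ?thesis .
qed

section \<open>Expected degrees\<close>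

text \<open>The un-neutralized region that must be free of eavesdroppers for an edge out of
  \<open>c\<close> of length \<open>r\<close>. It is closed at \<open>r\<close> because an edge
  needs a strict inequality, and strict at \<open>\<rho>\<close> because the neutralizing discs are
  closed.\<close>

definition gap :: "real \<Rightarrow> 'a::euclidean_space \<Rightarrow> real \<Rightarrow> 'a set \<Rightarrow> 'a set" where
  "gap \<rho> c r L = {e. dist c e \<le> r \<and> (\<forall>y\<in>L. \<rho> < dist y e)}"

lemma iS_edges_iff:
  assumes "x \<in> L" "y \<in> L"
  shows "(x, y) \<in> iS_edges \<rho> L E \<longleftrightarrow> E \<inter> gap \<rho> x (dist x y) L = {}"
proof -
  have "e \<in> - neutralization_region \<rho> L \<longleftrightarrow> (\<forall>z\<in>L. \<rho> < dist z e)" for e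
    by (simp add: neutralization_region_def not_le)
  then have "(x, y) \<in> iS_edges \<rho> L E \<longleftrightarrow> (\<forall>e\<in>E. (\<forall>z\<in>L. \<rho> < dist z e) \<longrightarrow> dist x y < dist x e)"
    using assms unfolding iS_edges_def by blast
  also have "\<dots> \<longleftrightarrow> E \<inter> gap \<rho> x (dist x y) L = {}"
    unfolding gap_def disjoint_iff mem_Collect_eq not_less[symmetric] by blast
  finally show ?thesis .
qed

text \<open>The out-degree is the case \<open>c = (\<lambda>_. 0)\<close>, the in-degree the case \<open>c = (\<lambda>x. x)\<close>.\<close>

definition gap_degree :: "('a::euclidean_space \<Rightarrow> 'a) \<Rightarrow> real \<Rightarrow> 'a set \<Rightarrow> 'a set \<Rightarrow> ennreal" where
  "gap_degree c \<rho> L E = (\<integral>\<^sup>+x. (if E \<inter> gap \<rho> (c x) (norm x) (insert 0 L) = {} then 1 else 0) \<partial>count_space L)"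

lemma emeasure_count_space_Collect:
  "emeasure (count_space UNIV) {x \<in> L. P x} = (\<integral>\<^sup>+x. (if P x then 1 else 0) \<partial>count_space L)"
proof -
  have "emeasure (count_space UNIV) {x \<in> L. P x} = (\<integral>\<^sup>+x. indicator {x \<in> L. P x} x \<partial>count_space UNIV)"
    by simp
  also have "\<dots> = (\<integral>\<^sup>+x. (if P x then 1 else 0) \<partial>count_space L)"
    by (subst nn_integral_count_space_indicator[of L]) (simp, rule nn_integral_cong, simp add: indicator_def)
  finally show ?thesis .
qed

lemma N_out_eq_gap_degree: "N_out \<rho> L E = gap_degree (\<lambda>_. 0) \<rho> L E"
  unfolding N_out_def gap_degree_def emeasure_count_space_Collect
  by (rule nn_integral_cong) (simp add: iS_edges_iff)

lemma N_in_eq_gap_degree: "N_in \<rho> L E = gap_degree (\<lambda>x. x) \<rho> L E"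
  unfolding N_in_def gap_degree_def emeasure_count_space_Collect
  by (rule nn_integral_cong) (simp add: iS_edges_iff)

lemma pred_mem_gap:
  fixes c :: "'a::euclidean_space \<Rightarrow> 'a"
  assumes [measurable]: "c \<in> borel_measurable borel"
  shows "Measurable.pred (borel \<Otimes>\<^sub>M (borel \<Otimes>\<^sub>M configuration_space))
    (\<lambda>(e, x, L). e \<in> gap \<rho> (c x) (norm (x :: 'a)) (insert z L))"
proof -
  have far: "Measurable.pred (configuration_space \<Otimes>\<^sub>M borel) (\<lambda>(L, e :: 'a). \<forall>y\<in>L. \<rho> < dist y e)"
    by (rule pred_Ball_configuration) measurable
  have "(\<lambda>(e, x, L). (L, e)) \<in> borel \<Otimes>\<^sub>M ((borel :: 'a measure) \<Otimes>\<^sub>M (configuration_space :: 'a set measure))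
      \<rightarrow>\<^sub>M configuration_space \<Otimes>\<^sub>M (borel :: 'a measure)"
    by measurable
  from measurable_compose[OF this far]
  have "Measurable.pred (borel \<Otimes>\<^sub>M ((borel :: 'a measure) \<Otimes>\<^sub>M configuration_space))
      (\<lambda>w. \<forall>y\<in>snd (snd w). \<rho> < dist y (fst w :: 'a))"
    by (simp add: case_prod_unfold)
  moreover have "Measurable.pred (borel \<Otimes>\<^sub>M ((borel :: 'a measure) \<Otimes>\<^sub>M configuration_space))
      (\<lambda>w. dist (c (fst (snd w))) (fst w) \<le> norm (fst (snd w)))"
    by measurable
  moreover have "Measurable.pred (borel \<Otimes>\<^sub>M ((borel :: 'a measure) \<Otimes>\<^sub>M configuration_space))
      (\<lambda>w. \<rho> < dist z (fst w))"
    by measurable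
  ultimately have "Measurable.pred (borel \<Otimes>\<^sub>M ((borel :: 'a measure) \<Otimes>\<^sub>M configuration_space))
      (\<lambda>w. dist (c (fst (snd w))) (fst w) \<le> norm (fst (snd w)) \<and> \<rho> < dist z (fst w) \<and>
        (\<forall>y\<in>snd (snd w). \<rho> < dist y (fst w)))"
    by - (intro pred_intros_logic(3); assumption)
  then show ?thesis
    by (simp add: gap_def case_prod_unfold)
qed

lemma gap_borel:
  fixes L :: "'a::euclidean_space set"
  assumes "L \<in> configurations"
  shows "gap \<rho> c r L \<in> sets borel"
proof -
  have far: "Measurable.pred (configuration_space \<Otimes>\<^sub>M borel) (\<lambda>(L, e :: 'a). \<forall>y\<in>L. \<rho> < dist y e)"
    by (rule pred_Ball_configuration) measurable
  have "(\<lambda>e :: 'a. (L, e)) \<in> borel \<rightarrow>\<^sub>M configuration_space \<Otimes>\<^sub>M borel"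
    using assms by (intro measurable_Pair) auto
  from measurable_compose[OF this far]
  have "Measurable.pred borel (\<lambda>e :: 'a. \<forall>y\<in>L. \<rho> < dist y e)"
    by simp
  moreover have "Measurable.pred borel (\<lambda>e :: 'a. dist c e \<le> r)"
    by measurable
  ultimately have "Measurable.pred borel (\<lambda>e :: 'a. dist c e \<le> r \<and> (\<forall>y\<in>L. \<rho> < dist y e))"
    by - (intro pred_intros_logic(3); assumption)
  then show ?thesis
    by (simp add: gap_def pred_def)
qed

lemma bounded_gap: "bounded (gap \<rho> c r L)"
  by (rule bounded_subset[OF bounded_cball[of c r]]) (auto simp: gap_def)

text \<open>Emptiness is a universal statement over the points of \<open>E\<close>, so
  \<open>pred_Ball_configuration\<close> applies a second time, now to the eavesdroppers.\<close>

lemma pred_gap_empty: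
  fixes c :: "'a::euclidean_space \<Rightarrow> 'a"
  assumes [measurable]: "c \<in> borel_measurable borel"
  shows "Measurable.pred ((borel \<Otimes>\<^sub>M configuration_space) \<Otimes>\<^sub>M configuration_space)
    (\<lambda>((x, L), E). E \<inter> gap \<rho> (c x) (norm (x :: 'a)) (insert z L) = {})"
proof -
  let ?C = "configuration_space :: 'a set measure" and ?B = "borel :: 'a measure"
  have "Measurable.pred (?B \<Otimes>\<^sub>M (?B \<Otimes>\<^sub>M ?C))
      (\<lambda>(e, w). \<not> (e \<in> gap \<rho> (c (fst w)) (norm (fst w)) (insert z (snd w))))"
    using pred_intros_logic(2)[OF pred_mem_gap[OF assms, of \<rho> z]] by (simp add: case_prod_unfold)
  then have gap: "Measurable.pred (?C \<Otimes>\<^sub>M (?B \<Otimes>\<^sub>M ?C))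
      (\<lambda>(E, w). \<forall>e\<in>E. \<not> (e \<in> gap \<rho> (c (fst w)) (norm (fst w)) (insert z (snd w))))"
    by (rule pred_Ball_configuration)
  have "(\<lambda>(w, E). (E, w)) \<in> (?B \<Otimes>\<^sub>M ?C) \<Otimes>\<^sub>M ?C
      \<rightarrow>\<^sub>M ?C \<Otimes>\<^sub>M (?B \<Otimes>\<^sub>M ?C)"
    by measurable
  from measurable_compose[OF this gap]
  have "Measurable.pred ((?B \<Otimes>\<^sub>M ?C) \<Otimes>\<^sub>M ?C)
      (\<lambda>v. \<forall>e\<in>snd v. \<not> (e \<in> gap \<rho> (c (fst (fst v))) (norm (fst (fst v) :: 'a)) (insert z (snd (fst v)))))"
    by (simp add: case_prod_unfold)
  then show ?thesis
    by (simp add: case_prod_unfold disjoint_iff Ball_def)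
qed

lemma borel_measurable_gap_degree:
  fixes c :: "'a::euclidean_space \<Rightarrow> 'a"
  assumes [measurable]: "c \<in> borel_measurable borel"
  shows "(\<lambda>(L, E). gap_degree c \<rho> L E) \<in> borel_measurable (configuration_space \<Otimes>\<^sub>M (configuration_space :: 'a set measure))"
proof -
  let ?C = "configuration_space :: 'a set measure"
  have "(\<lambda>(x, L, E). ((x, L), E)) \<in> (borel :: 'a measure) \<Otimes>\<^sub>M (?C \<Otimes>\<^sub>M ?C) \<rightarrow>\<^sub>M (borel \<Otimes>\<^sub>M ?C) \<Otimes>\<^sub>M ?C"
    by measurable
  from measurable_compose[OF this pred_gap_empty[OF assms, of \<rho> 0]]
  have [measurable]: "Measurable.pred (borel \<Otimes>\<^sub>M (?C \<Otimes>\<^sub>M ?C))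
      (\<lambda>v. snd (snd v) \<inter> gap \<rho> (c (fst v)) (norm (fst v)) (insert 0 (fst (snd v))) = {})"
    by (simp add: case_prod_unfold)
  have "(\<lambda>v. if snd (snd v) \<inter> gap \<rho> (c (fst v)) (norm (fst v)) (insert 0 (fst (snd v))) = {} then 1 else 0 :: ennreal)
      \<in> borel_measurable (borel \<Otimes>\<^sub>M (?C \<Otimes>\<^sub>M ?C))"
    by measurable
  from borel_measurable_sum_configuration[OF this]
  have sum: "(\<lambda>(S, w). \<integral>\<^sup>+x. (if snd w \<inter> gap \<rho> (c x) (norm x) (insert 0 (fst w)) = {} then 1 else 0) \<partial>count_space S)
      \<in> borel_measurable (?C \<Otimes>\<^sub>M (?C \<Otimes>\<^sub>M ?C))"
    by simp
  \<comment> \<open>The nodes play two parts, as the range of summation and as the source of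
    neutralization; duplicating \<open>L\<close> identifies the two.\<close>
  have "(\<lambda>(L, E). (L, L, E)) \<in> ?C \<Otimes>\<^sub>M ?C \<rightarrow>\<^sub>M ?C \<Otimes>\<^sub>M (?C \<Otimes>\<^sub>M ?C)"
    by measurable
  from measurable_compose[OF this sum] show ?thesis
    by (simp add: gap_degree_def case_prod_unfold)
qed

lemma sets_void:
  assumes "B \<in> sets borel" "bounded (B :: 'a::euclidean_space set)"
  shows "{S \<in> configurations. S \<inter> B = {}} \<in> sets configuration_space"
proof -
  have "{S \<in> configurations. S \<inter> B = {}} = cylinder {B} (\<lambda>_. 0)"
    using assms by (auto simp: cylinder_def finite_configuration_Int)
  then show ?thesis
    using assms sets_cylinder[of "{B}" "\<lambda>_. 0"] by simp
qed

lemma borel_measurable_measure_gap: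
  fixes c :: "'a::euclidean_space \<Rightarrow> 'a"
  assumes c: "c \<in> borel_measurable borel"
  shows "(\<lambda>(x, L). measure lborel (gap \<rho> (c x) (norm x) (insert z L)))
    \<in> borel_measurable (borel \<Otimes>\<^sub>M configuration_space)"
proof -
  let ?C = "configuration_space :: 'a set measure"
  have "(\<lambda>(w, e). (e, w)) \<in> (borel \<Otimes>\<^sub>M ?C) \<Otimes>\<^sub>M lborel \<rightarrow>\<^sub>M (borel :: 'a measure) \<Otimes>\<^sub>M (borel \<Otimes>\<^sub>M ?C)"
    by measurable
  from measurable_compose[OF this pred_mem_gap[OF c, of \<rho> z]]
  have "Measurable.pred ((borel \<Otimes>\<^sub>M ?C) \<Otimes>\<^sub>M lborel)
      (\<lambda>v. snd v \<in> gap \<rho> (c (fst (fst v))) (norm (fst (fst v))) (insert z (snd (fst v))))"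
    by (simp add: case_prod_unfold)
  then have "(\<lambda>w. emeasure lborel (gap \<rho> (c (fst w)) (norm (fst w)) (insert z (snd w))))
      \<in> borel_measurable (borel \<Otimes>\<^sub>M ?C)"
    by (intro lborel.measurable_emeasure) (auto simp: pred_def)
  then show ?thesis
    unfolding measure_def by (simp add: case_prod_unfold)
qed

lemma borel_measurable_exp_gap:
  fixes c :: "'a::euclidean_space \<Rightarrow> 'a"
  assumes c: "c \<in> borel_measurable borel"
  shows "(\<lambda>(x, L). ennreal (exp (- (a * measure lborel (gap \<rho> (c x) (norm x) (insert z L))))))
    \<in> borel_measurable (borel \<Otimes>\<^sub>M configuration_space)"
  using borel_measurable_measure_gap[OF c, of \<rho> z] unfolding case_prod_unfold
  by (intro measurable_compose[OF _ measurable_ennreal] borel_measurable_exp borel_measurable_uminus borel_measurable_times) auto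

section \<open>Mean degree for given legitimate nodes\<close>

context poisson_law
begin

lemma nn_integral_void:
  assumes B: "B \<in> sets borel" "bounded B"
  shows "(\<integral>\<^sup>+S. (if S \<inter> B = {} then 1 else 0) \<partial>Q) = ennreal (exp (- (d * measure lborel B)))"
proof -
  have "{S \<in> configurations. S \<inter> B = {}} \<in> sets Q"
    using sets_void[OF B] by (simp add: sets_Q)
  then have "emeasure Q {S \<in> configurations. S \<inter> B = {}} =
      (\<integral>\<^sup>+S. indicator {S \<in> configurations. S \<inter> B = {}} S \<partial>Q)"
    by (rule nn_integral_indicator[symmetric])
  also have "\<dots> = (\<integral>\<^sup>+S. (if S \<inter> B = {} then 1 else 0) \<partial>Q)"
    by (rule nn_integral_cong) (simp add: indicator_def)
  finally show ?thesis
    using void_probability[OF B] by simp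
qed

lemma nn_integral_gap_degree:
  fixes c :: "'a \<Rightarrow> 'a"
  assumes c: "c \<in> borel_measurable borel" and L: "L \<in> configurations"
  shows "(\<integral>\<^sup>+E. gap_degree c \<rho> L E \<partial>Q) =
    (\<integral>\<^sup>+x. ennreal (exp (- (d * measure lborel (gap \<rho> (c x) (norm x) (insert 0 L))))) \<partial>count_space L)"
proof -
  have L0: "insert 0 L \<in> configurations"
    using L by simp
  have "(\<integral>\<^sup>+E. gap_degree c \<rho> L E \<partial>Q) =
      (\<integral>\<^sup>+x. (\<integral>\<^sup>+E. (if E \<inter> gap \<rho> (c x) (norm x) (insert 0 L) = {} then 1 else 0) \<partial>Q) \<partial>count_space L)"
    unfolding gap_degree_def
  proof (rule pair_sigma_finite.Fubini'[OF pair_sigma_finite.intro])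
    show "sigma_finite_measure (count_space L)"
      using L by (intro sigma_finite_measure_count_space_countable countable_configuration)
    show "sigma_finite_measure Q" ..
    \<comment> \<open>Since \<open>L\<close> is countable, joint measurability reduces to
      measurability in \<open>E\<close> for each node \<open>x\<close>.\<close>
    show "(\<lambda>(x, E). if E \<inter> gap \<rho> (c x) (norm x) (insert 0 L) = {} then 1 else 0 :: ennreal)
        \<in> borel_measurable (count_space L \<Otimes>\<^sub>M Q)"
    proof (rule measurable_pair_measure_countable1)
      show "countable L" using L by (rule countable_configuration)
      fix x assume "x \<in> L"
      let ?B = "gap \<rho> (c x) (norm x) (insert 0 L)"
      have "{S \<in> space Q. S \<inter> ?B = {}} \<in> sets Q"
        using sets_void[OF gap_borel[OF L0] bounded_gap] by (simp add: sets_Q)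
      then have [measurable]: "Measurable.pred Q (\<lambda>S. S \<inter> ?B = {})"
        by (simp add: pred_def)
      then show "(\<lambda>E. case (x, E) of (x, E) \<Rightarrow> if E \<inter> gap \<rho> (c x) (norm x) (insert 0 L) = {} then 1 else (0 :: ennreal))
          \<in> borel_measurable Q"
        unfolding prod.case by measurable
    qed
  qed
  also have "\<dots> = (\<integral>\<^sup>+x. ennreal (exp (- (d * measure lborel (gap \<rho> (c x) (norm x) (insert 0 L))))) \<partial>count_space L)"
    by (intro nn_integral_cong nn_integral_void gap_borel[OF L0] bounded_gap)
  finally show ?thesis .
qed

end

lemma expected_gap_degree:
  fixes c :: "'a::euclidean_space \<Rightarrow> 'a"
  assumes Ql: "poisson_law Ql dl" and Qe: "poisson_law Qe de" and c: "c \<in> borel_measurable borel"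
  shows "(\<integral>\<^sup>+(L, E). gap_degree c \<rho> L E \<partial>(Ql \<Otimes>\<^sub>M Qe)) =
    ennreal dl * (\<integral>\<^sup>+x. (\<integral>\<^sup>+L. ennreal (exp (- (de * measure lborel (gap \<rho> (c x) (norm x) (insert 0 (insert x L)))))) \<partial>Ql) \<partial>lborel)"
proof -
  interpret Ql: poisson_law Ql dl by fact
  interpret Qe: poisson_law Qe de by fact
  have "sets (Ql \<Otimes>\<^sub>M Qe) = sets (configuration_space \<Otimes>\<^sub>M configuration_space)"
    by (intro sets_pair_measure_cong Ql.sets_Q Qe.sets_Q)
  then have meas: "(\<lambda>(L, E). gap_degree c \<rho> L E) \<in> borel_measurable (Ql \<Otimes>\<^sub>M Qe)"
    using borel_measurable_gap_degree[OF c, of \<rho>] measurable_cong_sets by blast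
  have "(\<integral>\<^sup>+(L, E). gap_degree c \<rho> L E \<partial>(Ql \<Otimes>\<^sub>M Qe)) = (\<integral>\<^sup>+L. (\<integral>\<^sup>+E. gap_degree c \<rho> L E \<partial>Qe) \<partial>Ql)"
    using Qe.nn_integral_fst[OF meas] by simp
  also have "\<dots> = (\<integral>\<^sup>+L. (\<integral>\<^sup>+x. (case (x, L) of (x, L) \<Rightarrow>
      ennreal (exp (- (de * measure lborel (gap \<rho> (c x) (norm x) (insert 0 L)))))) \<partial>count_space L) \<partial>Ql)"
    by (rule nn_integral_cong) (simp add: Qe.nn_integral_gap_degree[OF c])
  \<comment> \<open>The Mecke formula evaluates the summand at \<open>insert x L\<close>, so the
    node \<open>x\<close> appears with its own neutralizing disc.\<close>
  also have "\<dots> = ennreal dl * (\<integral>\<^sup>+x. (\<integral>\<^sup>+L. (case (x, insert x L) of (x, L) \<Rightarrow>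
      ennreal (exp (- (de * measure lborel (gap \<rho> (c x) (norm x) (insert 0 L)))))) \<partial>Ql) \<partial>lborel)"
    by (rule Ql.mecke[OF borel_measurable_exp_gap[OF c]])
  finally show ?thesis by simp
qed

text \<open>\<open>?T\<close> is an isometric involution that swaps \<open>0\<close> and
  \<open>x\<close>: it preserves the added pair of nodes, moves the disc about \<open>x\<close> to
  the one about \<open>0\<close>, and reflects the remaining nodes.\<close>

lemma gap_reflect:
  fixes x :: "'a::euclidean_space"
  shows "gap \<rho> x r (insert 0 (insert x L)) = (\<lambda>y. x - y) ` gap \<rho> 0 r (insert 0 (insert x ((\<lambda>y. x - y) ` L)))"
    (is "?A = ?T ` ?B")
proof -
  have D: "dist y (x - e) = dist (x - y) e" for y e
    using norm_minus_commute[of "y - (x - e)" 0] by (simp add: dist_norm algebra_simps)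
  have mem: "x - e \<in> ?A \<longleftrightarrow> e \<in> ?B" for e
    by (auto simp: gap_def D) (simp_all add: dist_norm)
  show ?thesis
  proof (intro set_eqI iffI)
    fix e assume "e \<in> ?A"
    then have "x - e \<in> ?B" using mem[of "x - e"] by simp
    then show "e \<in> ?T ` ?B" by (intro image_eqI[of _ _ "x - e"]) auto
  qed (use mem in blast)
qed

text \<open>For a fixed \<open>L\<close> the two volumes may differ; the gap at \<open>x\<close> has
  the volume of the gap at \<open>0\<close> for the reflected configuration, and invariance of the
  law removes the reflection after integration.\<close>

lemma (in poisson_law) nn_integral_exp_gap_reflect:
  fixes x :: 'a
  shows "(\<integral>\<^sup>+L. ennreal (exp (- (a * measure lborel (gap \<rho> x (norm x) (insert 0 (insert x L)))))) \<partial>Q) =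
    (\<integral>\<^sup>+L. ennreal (exp (- (a * measure lborel (gap \<rho> 0 (norm x) (insert 0 (insert x L)))))) \<partial>Q)"
proof -
  define k where "k L = ennreal (exp (- (a * measure lborel (gap \<rho> 0 (norm x) (insert 0 (insert x L))))))" for L
  have k: "k \<in> borel_measurable Q"
    using measurable_compose[OF measurable_Pair_insert borel_measurable_exp_gap[of "\<lambda>_. 0" a \<rho> 0]]
    by (simp add: k_def[abs_def] measurable_cong_sets[OF sets_Q refl])
  have T: "(`) (\<lambda>y. x - y) \<in> Q \<rightarrow>\<^sub>M Q"
    using measurable_reflect_configuration by (simp add: measurable_cong_sets[OF sets_Q sets_Q])
  have "(\<integral>\<^sup>+L. ennreal (exp (- (a * measure lborel (gap \<rho> x (norm x) (insert 0 (insert x L)))))) \<partial>Q) =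
      (\<integral>\<^sup>+L. k ((\<lambda>y. x - y) ` L) \<partial>Q)"
  proof (rule nn_integral_cong)
    fix L assume "L \<in> space Q"
    then have "gap \<rho> 0 (norm x) (insert 0 (insert x ((\<lambda>y. x - y) ` L))) \<in> sets borel"
      by (intro gap_borel) (simp add: reflect_configurations)
    then show "ennreal (exp (- (a * measure lborel (gap \<rho> x (norm x) (insert 0 (insert x L)))))) =
        k ((\<lambda>y. x - y) ` L)"
      unfolding k_def gap_reflect[of \<rho> x _ L] by (simp add: measure_lborel_reflect)
  qed
  also have "\<dots> = (\<integral>\<^sup>+L. k L \<partial>distr Q Q ((`) (\<lambda>y. x - y)))"
    using T k by (intro nn_integral_distr[symmetric]) simp_all
  also have "\<dots> = (\<integral>\<^sup>+L. k L \<partial>Q)"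
    by (simp only: distr_reflect)
  finally show ?thesis
    by (simp only: k_def)
qed

section \<open>The lower bound\<close>

text \<open>The tangent to \<open>exp (- v)\<close> at \<open>v = m\<close>, with the term linear in
  \<open>v\<close> moved across so that both sides are nonnegative when \<open>m\<close> and
  \<open>v\<close> are.\<close>

lemma exp_tangent_bound:
  fixes m v :: real
  shows "exp (- m) * (1 + m) \<le> exp (- v) + exp (- m) * v"
proof -
  have "1 + (m - v) \<le> exp (m - v)"
    by (rule exp_ge_add_one_self)
  then have "exp (- m) * (1 + (m - v)) \<le> exp (- m) * exp (m - v)"
    by (intro mult_left_mono) auto
  also have "\<dots> = exp (- v)"
    by (simp flip: exp_add)
  finally show ?thesis
    by (simp add: algebra_simps)
qed

text \<open>Jensen's inequality for \<open>exp\<close>, integrated from the tangent bound with both sides arranged as sums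
  of nonnegative terms, so that no integrability has to be established.\<close>

lemma (in prob_space) nn_integral_exp_ge:
  fixes V :: "'a \<Rightarrow> real"
  assumes [measurable]: "V \<in> borel_measurable M" and V: "\<And>x. x \<in> space M \<Longrightarrow> 0 \<le> V x"
    and m: "0 \<le> m" and le: "(\<integral>\<^sup>+x. ennreal (V x) \<partial>M) \<le> ennreal m"
  shows "ennreal (exp (- m)) \<le> (\<integral>\<^sup>+x. ennreal (exp (- V x)) \<partial>M)"
proof -
  have "ennreal (exp (- m)) + ennreal (exp (- m) * m) = (\<integral>\<^sup>+x. ennreal (exp (- m) * (1 + m)) \<partial>M)"
    using m by (simp add: emeasure_space_1 algebra_simps flip: ennreal_plus)
  also have "\<dots> \<le> (\<integral>\<^sup>+x. ennreal (exp (- V x)) + ennreal (exp (- m)) * ennreal (V x) \<partial>M)"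
    using exp_tangent_bound[of m] V by (intro nn_integral_mono) (simp flip: ennreal_mult ennreal_plus add: ennreal_leI)
  also have "\<dots> = (\<integral>\<^sup>+x. ennreal (exp (- V x)) \<partial>M) + ennreal (exp (- m)) * (\<integral>\<^sup>+x. ennreal (V x) \<partial>M)"
    by (simp add: nn_integral_add nn_integral_cmult)
  also have "\<dots> \<le> (\<integral>\<^sup>+x. ennreal (exp (- V x)) \<partial>M) + ennreal (exp (- m) * m)"
    using le m by (simp add: ennreal_mult add_left_mono mult_left_mono)
  \<comment> \<open>The common summand \<open>exp (- m) * m\<close> is finite, so it cancels in
    \<open>ennreal\<close>.\<close>
  finally show ?thesis
    by (simp add: ennreal_add_left_cancel_le add.commute)
qed

text \<open>The node at the origin clears its own disc. This leaves an annulus when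
  \<open>\<rho> < norm x\<close> and nothing otherwise.\<close>

lemma gap_subset_annulus:
  "gap \<rho> 0 (norm x) (insert 0 (insert x L)) \<subseteq> cball 0 (norm x) - cball 0 \<rho>"
  by (auto simp: gap_def)

context poisson_law
begin

text \<open>Robbins' formula: by Fubini the mean volume of a random set is the integral of the
  probability that it contains a given point. A point of the gap has no node within distance
  \<open>\<rho>\<close>, which bounds that probability by a void probability.\<close>

lemma nn_integral_measure_gap_le:
  fixes x :: 'a
  shows "(\<integral>\<^sup>+L. ennreal (measure lborel (gap \<rho> 0 (norm x) (insert 0 (insert x L)))) \<partial>Q) \<le>
    ennreal (exp (- (d * measure lborel (cball (0::'a) \<rho>)))) * emeasure lborel (cball 0 (norm x) - cball (0::'a) \<rho>)"
proof -
  let ?G = "\<lambda>L. gap \<rho> 0 (norm x) (insert 0 (insert x L))"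
  let ?C = "configuration_space :: 'a set measure"
  have "(\<lambda>(L, e). (e, x, insert x L)) \<in> Q \<Otimes>\<^sub>M lborel \<rightarrow>\<^sub>M borel \<Otimes>\<^sub>M (borel \<Otimes>\<^sub>M ?C)"
  proof -
    have "insert x \<in> Q \<rightarrow>\<^sub>M ?C"
      by (simp add: measurable_cong_sets[OF sets_Q refl])
    from measurable_compose[OF measurable_fst this]
    have "(\<lambda>v. insert x (fst v)) \<in> Q \<Otimes>\<^sub>M lborel \<rightarrow>\<^sub>M ?C"
      by simp
    then show ?thesis
      unfolding case_prod_unfold by (intro measurable_Pair) simp_all
  qed
  from measurable_compose[OF this pred_mem_gap[of "\<lambda>_. 0" \<rho> 0]]
  have [measurable]: "Measurable.pred (Q \<Otimes>\<^sub>M lborel) (\<lambda>v. snd v \<in> ?G (fst v))"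
    by (simp add: case_prod_unfold)
  have "(\<integral>\<^sup>+L. ennreal (measure lborel (?G L)) \<partial>Q) =
      (\<integral>\<^sup>+L. (\<integral>\<^sup>+e. (if e \<in> ?G L then 1 else 0) \<partial>lborel) \<partial>Q)"
  proof (rule nn_integral_cong)
    fix L assume "L \<in> space Q"
    then have G: "?G L \<in> sets borel"
      by (intro gap_borel) simp
    have "ennreal (measure lborel (?G L)) = emeasure lborel (?G L)"
      using emeasure_bounded_finite[OF bounded_gap[of \<rho> 0 "norm x" "insert 0 (insert x L)"]]
      by (intro emeasure_eq_ennreal_measure[symmetric]) auto
    also have "\<dots> = (\<integral>\<^sup>+e. indicator (?G L) e \<partial>lborel)"
      using G by simp
    also have "\<dots> = (\<integral>\<^sup>+e. (if e \<in> ?G L then 1 else 0) \<partial>lborel)"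
      by (rule nn_integral_cong) (simp add: indicator_def)
    finally show "ennreal (measure lborel (?G L)) = (\<integral>\<^sup>+e. (if e \<in> ?G L then 1 else 0) \<partial>lborel)" .
  qed
  also have "\<dots> = (\<integral>\<^sup>+e. (\<integral>\<^sup>+L. (if e \<in> ?G L then 1 else 0) \<partial>Q) \<partial>lborel)"
  proof (rule pair_sigma_finite.Fubini'[symmetric, OF pair_sigma_finite.intro])
    show "(\<lambda>(L, e). if e \<in> ?G L then 1 else (0 :: ennreal)) \<in> borel_measurable (Q \<Otimes>\<^sub>M lborel)"
      unfolding case_prod_unfold by measurable
  qed (rule sigma_finite_measure_axioms lborel.sigma_finite_measure_axioms)+
  also have "\<dots> \<le> (\<integral>\<^sup>+e. ennreal (exp (- (d * measure lborel (cball (0::'a) \<rho>)))) *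
      indicator (cball (0::'a) (norm x) - cball 0 \<rho>) e \<partial>lborel)"
  proof (rule nn_integral_mono)
    fix e :: 'a
    show "(\<integral>\<^sup>+L. (if e \<in> ?G L then 1 else 0) \<partial>Q) \<le>
        ennreal (exp (- (d * measure lborel (cball (0::'a) \<rho>)))) * indicator (cball 0 (norm x) - cball 0 \<rho>) e"
    proof (cases "e \<in> cball 0 (norm x) - cball 0 \<rho>")
      case True
      \<comment> \<open>Only the discs about the points of \<open>L\<close> are retained here; the
        disc about \<open>x\<close> could remove further area, whence an inequality.\<close>
      have "(\<integral>\<^sup>+L. (if e \<in> ?G L then 1 else 0) \<partial>Q) \<le> (\<integral>\<^sup>+L. (if L \<inter> cball e \<rho> = {} then 1 else 0) \<partial>Q)"
        by (intro nn_integral_mono) (auto simp: gap_def dist_commute)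
      also have "\<dots> = ennreal (exp (- (d * measure lborel (cball e \<rho>))))"
        by (rule nn_integral_void) auto
      \<comment> \<open>Translation invariance; for negative \<open>\<rho>\<close> both balls are
        empty.\<close>
      also have "measure lborel (cball e \<rho>) = measure lborel (cball (0::'a) \<rho>)"
        by (cases "\<rho> \<ge> 0") (simp_all add: content_cball)
      finally show ?thesis using True by simp
    next
      case False
      then have "e \<notin> ?G L" for L
        using gap_subset_annulus by blast
      then show ?thesis by simp
    qed
  qed
  also have "\<dots> = ennreal (exp (- (d * measure lborel (cball (0::'a) \<rho>)))) * emeasure lborel (cball 0 (norm x) - cball (0::'a) \<rho>)"
    by (intro nn_integral_cmult_indicator) simp
  finally show ?thesis .
qed

end

text \<open>In the plane the annulus has area
  \<open>pi * ((norm x)\<^sup>2 - \<rho>\<^sup>2)\<close>, so the Jensen exponent is linear in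
  \<open>(norm x)\<^sup>2\<close> and the bound is Gaussian in \<open>x\<close>.\<close>

lemma nn_integral_exp_gap_ge:
  fixes x :: plane
  assumes Q: "poisson_law Q d" and a: "a \<ge> 0" and \<rho>: "\<rho> \<ge> 0" and x: "\<rho> \<le> norm x"
  shows "ennreal (exp (- (a * exp (- (pi * d * \<rho>\<^sup>2)) * pi) * ((norm x)\<^sup>2 - \<rho>\<^sup>2))) \<le>
    (\<integral>\<^sup>+L. ennreal (exp (- (a * measure lborel (gap \<rho> 0 (norm x) (insert 0 (insert x L)))))) \<partial>Q)"
proof -
  interpret poisson_law Q d by fact
  let ?V = "\<lambda>L. a * measure lborel (gap \<rho> 0 (norm x) (insert 0 (insert x L)))"
  \<comment> \<open>Upper bound for the mean of \<open>?V\<close>: the eavesdropper density times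
    the probability of escaping neutralization times the area of the annulus.\<close>
  let ?m = "a * (exp (- (pi * d * \<rho>\<^sup>2)) * (pi * ((norm x)\<^sup>2 - \<rho>\<^sup>2)))"
  have sq: "\<rho>\<^sup>2 \<le> (norm x)\<^sup>2"
    using \<rho> x by (rule power_mono[rotated])
  have [measurable]: "(\<lambda>L. measure lborel (gap \<rho> 0 (norm x) (insert 0 (insert x L)))) \<in> borel_measurable Q"
    using measurable_compose[OF measurable_Pair_insert borel_measurable_measure_gap[of "\<lambda>_. 0" \<rho> 0]]
    by (simp add: measurable_cong_sets[OF sets_Q refl])
  have "(\<integral>\<^sup>+L. ennreal (?V L) \<partial>Q) =
      ennreal a * (\<integral>\<^sup>+L. ennreal (measure lborel (gap \<rho> 0 (norm x) (insert 0 (insert x L)))) \<partial>Q)"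
    using a by (subst nn_integral_cmult[symmetric]) (auto simp: ennreal_mult)
  also have "\<dots> \<le> ennreal a * (ennreal (exp (- (d * measure lborel (cball (0::plane) \<rho>)))) *
      emeasure lborel (cball 0 (norm x) - cball (0::plane) \<rho>))"
    by (intro mult_left_mono nn_integral_measure_gap_le) simp
  also have "\<dots> = ennreal ?m"
    using \<rho> x sq a by (simp add: emeasure_annulus content_cball unit_ball_vol_2 ennreal_mult mult_ac)
  finally have "ennreal (exp (- ?m)) \<le> (\<integral>\<^sup>+L. ennreal (exp (- ?V L)) \<partial>Q)"
    using sq a by (intro nn_integral_exp_ge) auto
  then show ?thesis
    by (simp add: mult_ac)
qed

theorem theorem4p2:
  fixes M :: "'w measure"
    and P\<^sub>l P\<^sub>e :: "'w \<Rightarrow> plane set"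
    and d\<^sub>l d\<^sub>e \<rho> :: real
  assumes "prob_space M"
    and "d\<^sub>l > 0" and "d\<^sub>e > 0" and "\<rho> \<ge> 0"
    and "homogeneous_poisson_process M d\<^sub>l P\<^sub>l"
    and "homogeneous_poisson_process M d\<^sub>e P\<^sub>e"
    and "prob_space.indep_var M configuration_space P\<^sub>l configuration_space P\<^sub>e"
  shows "(\<integral>\<^sup>+\<omega>. N_in \<rho> (P\<^sub>l \<omega>) (P\<^sub>e \<omega>) \<partial>M) = (\<integral>\<^sup>+\<omega>. N_out \<rho> (P\<^sub>l \<omega>) (P\<^sub>e \<omega>) \<partial>M) \<and>
    (\<integral>\<^sup>+\<omega>. N_out \<rho> (P\<^sub>l \<omega>) (P\<^sub>e \<omega>) \<partial>M) \<ge>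
      ennreal (d\<^sub>l / d\<^sub>e * (pi * d\<^sub>e * \<rho>\<^sup>2 + exp (pi * d\<^sub>l * \<rho>\<^sup>2)))"
proof -
  interpret prob_space M by fact
  let ?C = "configuration_space :: plane set measure"
  define Ql where "Ql = distr M ?C P\<^sub>l"
  define Qe where "Qe = distr M ?C P\<^sub>e"
  have Ql: "poisson_law Ql d\<^sub>l" and Qe: "poisson_law Qe d\<^sub>e"
    unfolding Ql_def Qe_def using assms by (auto intro: poisson_law_distr)
  interpret Ql: poisson_law Ql d\<^sub>l by (rule Ql)
  have pair: "(\<lambda>\<omega>. (P\<^sub>l \<omega>, P\<^sub>e \<omega>)) \<in> M \<rightarrow>\<^sub>M ?C \<Otimes>\<^sub>M ?C"
    using assms(5,6) by (intro measurable_Pair) (auto simp: homogeneous_poisson_process_def)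
  \<comment> \<open>Independence enters only here: the joint law is a product, so eavesdroppers can
    be averaged out for fixed nodes.\<close>
  have joint: "Ql \<Otimes>\<^sub>M Qe = distr M (?C \<Otimes>\<^sub>M ?C) (\<lambda>\<omega>. (P\<^sub>l \<omega>, P\<^sub>e \<omega>))"
    using assms(7) by (simp add: indep_var_distribution_eq Ql_def Qe_def)
  \<comment> \<open>For \<open>c = 0\<close> and \<open>c = x\<close>, the probability of the edge
    between \<open>0\<close> and \<open>x\<close> that starts in \<open>c\<close>, once both are
    added as nodes.\<close>
  define W where "W c x = (\<integral>\<^sup>+L. ennreal (exp (- (d\<^sub>e * measure lborel (gap \<rho> c (norm x) (insert 0 (insert x L)))))) \<partial>Ql)"
    for c x :: plane
  have deg: "(\<integral>\<^sup>+\<omega>. gap_degree c \<rho> (P\<^sub>l \<omega>) (P\<^sub>e \<omega>) \<partial>M) = ennreal d\<^sub>l * (\<integral>\<^sup>+x. W (c x) x \<partial>lborel)"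
    if c: "c \<in> borel_measurable borel" for c :: "plane \<Rightarrow> plane"
  proof -
    have "(\<integral>\<^sup>+\<omega>. gap_degree c \<rho> (P\<^sub>l \<omega>) (P\<^sub>e \<omega>) \<partial>M) = (\<integral>\<^sup>+(L, E). gap_degree c \<rho> L E \<partial>(Ql \<Otimes>\<^sub>M Qe))"
      unfolding joint using nn_integral_distr[OF pair, of "\<lambda>(L, E). gap_degree c \<rho> L E"] borel_measurable_gap_degree[OF c]
      by simp
    then show ?thesis
      unfolding W_def using expected_gap_degree[OF Ql Qe c] by simp
  qed
  have "W x x = W 0 x" for x
    unfolding W_def by (rule Ql.nn_integral_exp_gap_reflect)
  then have eq: "(\<integral>\<^sup>+\<omega>. N_in \<rho> (P\<^sub>l \<omega>) (P\<^sub>e \<omega>) \<partial>M) = (\<integral>\<^sup>+\<omega>. N_out \<rho> (P\<^sub>l \<omega>) (P\<^sub>e \<omega>) \<partial>M)"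
    by (simp add: N_in_eq_gap_degree N_out_eq_gap_degree deg)
  \<comment> \<open>The coefficient of \<open>(norm x)\<^sup>2 - \<rho>\<^sup>2\<close> in the
    Jensen exponent for eavesdropper density \<open>d\<^sub>e\<close>.\<close>
  define c where "c = d\<^sub>e * exp (- (pi * d\<^sub>l * \<rho>\<^sup>2)) * pi"
  have c: "c > 0"
    using assms(3) by (simp add: c_def)
  \<comment> \<open>The two indicators split the plane: inside the disc the gap is empty and the
    edge is certain, outside the Jensen bound applies.\<close>
  have W_ge: "indicator (cball 0 \<rho>) x + ennreal (exp (- c * ((norm x)\<^sup>2 - \<rho>\<^sup>2))) * indicator {x. \<rho> < norm x} x \<le> W 0 x"
    for x :: plane
  proof (cases "\<rho> < norm x")
    case True
    then show ?thesis
      unfolding W_def c_def using nn_integral_exp_gap_ge[OF Ql, of d\<^sub>e \<rho> x] assms(3,4) by simp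
  next
    case False
    then have "gap \<rho> 0 (norm x) (insert 0 (insert x L)) = {}" for L
      using gap_subset_annulus[of \<rho> x L] by auto
    then show ?thesis
      unfolding W_def using False by (simp add: Ql.emeasure_space_1[simplified])
  qed
  have "ennreal (d\<^sub>l / d\<^sub>e * (pi * d\<^sub>e * \<rho>\<^sup>2 + exp (pi * d\<^sub>l * \<rho>\<^sup>2))) = ennreal d\<^sub>l * (ennreal (pi * \<rho>\<^sup>2) + ennreal (pi / c))"
  proof -
    \<comment> \<open>Here
      \<open>pi / c = exp (pi * d\<^sub>l * \<rho>\<^sup>2) / d\<^sub>e\<close>: the inverse of the
      escape probability turns into the growing exponential of the claim.\<close>
    have "d\<^sub>l / d\<^sub>e * (pi * d\<^sub>e * \<rho>\<^sup>2 + exp (pi * d\<^sub>l * \<rho>\<^sup>2)) = d\<^sub>l * (pi * \<rho>\<^sup>2 + pi / c)"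
      using assms(3) by (simp add: c_def exp_minus field_simps)
    also have "ennreal \<dots> = ennreal d\<^sub>l * ennreal (pi * \<rho>\<^sup>2 + pi / c)"
      using assms(2) c by (intro ennreal_mult) auto
    also have "ennreal (pi * \<rho>\<^sup>2 + pi / c) = ennreal (pi * \<rho>\<^sup>2) + ennreal (pi / c)"
      using c by (intro ennreal_plus) auto
    finally show ?thesis .
  qed
  also have "ennreal (pi * \<rho>\<^sup>2) + ennreal (pi / c) =
      (\<integral>\<^sup>+x. indicator (cball (0::plane) \<rho>) x + ennreal (exp (- c * ((norm x)\<^sup>2 - \<rho>\<^sup>2))) * indicator {x. \<rho> < norm x} x \<partial>lborel)"
    using assms(4) nn_integral_gaussian_outside_ball[OF c assms(4)]
    by (subst nn_integral_add) (auto simp: emeasure_cball unit_ball_vol_2 intro: borel_measurable_indicator)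
  also have "ennreal d\<^sub>l * \<dots> \<le> ennreal d\<^sub>l * (\<integral>\<^sup>+x. W 0 x \<partial>lborel)"
    by (intro mult_left_mono nn_integral_mono W_ge) simp
  also have "\<dots> = (\<integral>\<^sup>+\<omega>. N_out \<rho> (P\<^sub>l \<omega>) (P\<^sub>e \<omega>) \<partial>M)"
    by (simp add: N_out_eq_gap_degree deg)
  finally show ?thesis
    using eq by simp
qed

end
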